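(* Fix a finite set $\mathcal{G}$ of single-qubit and two-qubit quantum gates that is closed under controlled operation. There is a constant $k$ and a family of quantum circuits $\{U_{n,c}\}$ such that, for all $n,c$, $U_{n,c}$ is universal for the collection of all circuits with $c$ gates from $\mathcal{G}$ acting on $n$ qubits, and $\mathrm{SIZE}(U_{n,c}) = k(n+c)\log(n+c)$.
   Context: The size $\mathrm{SIZE}(U)$ of a circuit $U$ is its number of gates. A set of gates $\mathcal{G}$ is closed under controlled operation if for each $G\in\mathcal{G}$, the controlled gate $\lvert c\rangle\lvert t\rangle\mapsto \lvert c\rangle G^c\lvert t\rangle$ (with $c$ a single control qubit) can be implemented by a circuit of constant depth and size using gates from $\mathcal{G}$. Universal circuit: fix $n>0$ and a collection $\mathcal{C}$ of quantum circuits on $n$ qubits. A quantum circuit $U$ on $n+m$ qubits (possibly plus ancilla qubits initialized to and returned to $\lvert 0\rangle$) is universal for $\mathcal{C}$ if for every $C\in\mathcal{C}$ there is a string $x\in\{0,1\}^m$ (the encoding) such that for all $y\in\{0,1\}^n$, $U(\lvert y\rangle\otimes\lvert x\rangle) = C\lvert y\rangle\otimes\lvert x\rangle$.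
   Formalization: The size is exactly k(n+c)⌈log₂(n+c)⌉, since k(n+c)log(n+c) is not an integer in general; U is built from gates of G, plus the controlled-SWAP gate when G cannot implement it exactly; controlled gates may be implemented with clean ancillas. *)

theory Defs
  imports Complex_Main "Jordan_Normal_Form.Schur_Decomposition"
begin

text \<open>
  Qubits are numbered from 0 and the usual big-endian convention is used: qubit 0 is the most
  significant bit of a basis index, so that \<open>tensor_vec\<close> is the ordinary Kronecker product and a
  control qubit placed first gives the block matrix diag(1, M).
\<close>

definition bits_index :: "bool list \<Rightarrow> nat" where
  "bits_index bs = horner_sum of_bool 2 (rev bs)"

definition qubit_val :: "nat \<Rightarrow> nat \<Rightarrow> nat \<Rightarrow> bool" where
  "qubit_val N i q = bit i (N - 1 - q)"

definition ket :: "bool list \<Rightarrow> complex vec" where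
  "ket bs = unit_vec (2 ^ length bs) (bits_index bs)"

definition tensor_vec :: "complex vec \<Rightarrow> complex vec \<Rightarrow> complex vec" (infixr "\<otimes>\<^sub>v" 66) where
  "v \<otimes>\<^sub>v w = vec (dim_vec v * dim_vec w) (\<lambda>i. v $ (i div dim_vec w) * w $ (i mod dim_vec w))"

definition quantum_gate :: "nat \<Rightarrow> complex mat \<Rightarrow> bool" where
  "quantum_gate k M \<longleftrightarrow> M \<in> carrier_mat (2 ^ k) (2 ^ k) \<and>
     mat_adjoint M * M = 1\<^sub>m (2 ^ k) \<and> M * mat_adjoint M = 1\<^sub>m (2 ^ k)"

definition controlled :: "complex mat \<Rightarrow> complex mat" where
  "controlled M = four_block_mat (1\<^sub>m (dim_row M)) (0\<^sub>m (dim_row M) (dim_col M))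
                                 (0\<^sub>m (dim_row M) (dim_col M)) M"

definition swap_gate :: "complex mat" where
  "swap_gate = mat_of_rows_list 4 [[1,0,0,0], [0,0,1,0], [0,1,0,0], [0,0,0,1]]"

text \<open>
  A circuit is the sequence of its gates in order of application, each with the list of distinct
  qubits it acts on (in the order of the tensor factors of its matrix). Its size is its length.
\<close>

type_synonym circuit = "(complex mat \<times> nat list) list"

definition circuit_over :: "complex mat set \<Rightarrow> nat \<Rightarrow> circuit \<Rightarrow> bool" where
  "circuit_over G N C \<longleftrightarrow> (\<forall>(M, qs) \<in> set C. M \<in> G \<and> dim_row M = 2 ^ length qs \<and>
      distinct qs \<and> set qs \<subseteq> {..<N})"

text \<open>The gate \<open>M\<close> on the qubits \<open>qs\<close>, tensored with the identity on the other qubits of \<open>N\<close>.\<close>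

definition gate_on :: "nat \<Rightarrow> complex mat \<times> nat list \<Rightarrow> complex mat" where
  "gate_on N = (\<lambda>(M, qs). mat (2 ^ N) (2 ^ N) (\<lambda>(i, j).
      if \<forall>q<N. q \<notin> set qs \<longrightarrow> qubit_val N i q = qubit_val N j q
      then M $$ (bits_index (map (qubit_val N i) qs), bits_index (map (qubit_val N j) qs))
      else 0))"

fun circuit_mat :: "nat \<Rightarrow> circuit \<Rightarrow> complex mat" where
  "circuit_mat N [] = 1\<^sub>m (2 ^ N)"
| "circuit_mat N (g # C) = circuit_mat N C * gate_on N g"

definition circuit_size :: "circuit \<Rightarrow> nat" where
  "circuit_size C = length C"

text \<open>
  Exact implementation of a \<open>k\<close>-qubit unitary, possibly with \<open>a\<close> ancilla qubits that are
  initialized to and returned to 0.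
\<close>

definition implements :: "nat \<Rightarrow> nat \<Rightarrow> circuit \<Rightarrow> complex mat \<Rightarrow> bool" where
  "implements k a C V \<longleftrightarrow> (\<forall>y. length y = k \<longrightarrow>
      circuit_mat (k + a) C *\<^sub>v (ket y \<otimes>\<^sub>v ket (replicate a False)) =
      (V *\<^sub>v ket y) \<otimes>\<^sub>v ket (replicate a False))"

text \<open>
  The bound \<open>s\<close> on the size also bounds the depth, which never exceeds the size.
\<close>

definition closed_under_control :: "complex mat set \<Rightarrow> bool" where
  "closed_under_control G \<longleftrightarrow> (\<exists>s. \<forall>k. \<forall>M\<in>G. quantum_gate k M \<longrightarrow>
      (\<exists>a C. circuit_over G (Suc k + a) C \<and> circuit_size C \<le> s \<and>
             implements (Suc k) a C (controlled M)))"

text \<open>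
  The gates a universal circuit is built from: those of \<open>G\<close>, which by closure under control
  provide the switchable gates. Routing the simulated wires takes controlled swaps; closure under
  control does not by itself say that \<open>G\<close> generates them, so the controlled swap is
  adjoined exactly when no circuit over \<open>G\<close> implements it.
\<close>

definition simulation_gates :: "complex mat set \<Rightarrow> complex mat set" where
  "simulation_gates G =
     (if \<exists>a C. circuit_over G (3 + a) C \<and> implements 3 a C (controlled swap_gate)
      then G else insert (controlled swap_gate) G)"

text \<open>
  \<open>U\<close> acts on \<open>n\<close> data qubits, followed by \<open>m\<close> encoding qubits and \<open>a\<close> ancilla qubits.
\<close>

definition universal_for :: "nat \<Rightarrow> nat \<Rightarrow> nat \<Rightarrow> circuit \<Rightarrow> circuit set \<Rightarrow> bool" where
  "universal_for n m a U Cs \<longleftrightarrow> (\<forall>C\<in>Cs. \<exists>x. length x = m \<and> (\<forall>y. length y = n \<longrightarrow>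
      circuit_mat (n + m + a) U *\<^sub>v (ket y \<otimes>\<^sub>v ket x \<otimes>\<^sub>v ket (replicate a False)) =
      (circuit_mat n C *\<^sub>v ket y) \<otimes>\<^sub>v ket x \<otimes>\<^sub>v ket (replicate a False)))"

end

theory Submission
  imports Defs "HOL-Library.Sublist"
begin

text \<open>
  Give every gate of a fixed list its own encoding qubit as control: the encoding then selects an
  arbitrary subsequence of the list. So it suffices to find a list of \<open>O((n + c) log (n + c))\<close> swaps and
  gates from \<open>G\<close> such that every circuit with \<open>c\<close> gates arises, up to moving qubits around, from a
  subsequence. The data qubits are kept in a memory with a single port, which is accessed a constant
  number of times per gate. The memory is built from two memories of half the size and three optional
  swaps for every two accesses; which half a qubit travels through is a two-colouring of a bipartite
  graph of degree two, as in a Benes network. Hence \<open>T\<close> accesses cost \<open>O(T log T)\<close> swaps.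
\<close>

section \<open>Circuits acting on amplitude functions\<close>

text \<open>Gates sit on fixed wires, so the pattern of a simulated circuit has to be turned from
  space into time: every simulated gate acts on the port, a binary one also on a work wire, and the
  encoding only decides which qubits have arrived there. The encoding may depend on the whole
  simulated circuit, so all accesses are known in advance: each time at which a qubit enters the
  memory is matched with the time of its next use, and routing this matching is a static problem.
  Selection is exact because encodings are basis states: a control in a basis state is a classical
  switch and stays unchanged. Qubits cannot be copied, so every access is an exchange and whatever
  sat at the port is carried off; this other content need not be followed, as it is all zero once
  the data is back on its own wires. The form of the size is a separate obstacle: it has to equal a
  fixed multiple of \<open>(n + c) * log (n + c)\<close>, not just stay below it, while the gates of
  \<open>G\<close> have controlled implementations of unrelated lengths.\<close>

text \<open>
  A state is a function from assignments of bits to all wires \<open>0, 1, 2, \<dots>\<close> to amplitudes, so that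
  enlarging the register or adding ancillas in state 0 does not change it.
\<close>

definition vals :: "nat \<Rightarrow> nat \<Rightarrow> nat \<Rightarrow> bool" where
  "vals N i q \<longleftrightarrow> q < N \<and> qubit_val N i q"

definition upd_wires :: "(nat \<Rightarrow> bool) \<Rightarrow> nat list \<Rightarrow> bool list \<Rightarrow> nat \<Rightarrow> bool" where
  "upd_wires b qs bs q = (case map_of (zip qs bs) q of None \<Rightarrow> b q | Some v \<Rightarrow> v)"

text \<open>The action of \<open>gate_on\<close> without a register size: the row index is read off
  the target assignment \<open>b\<close>, the column index off the source \<open>bs\<close>.\<close>

definition apply_gate ::
  "complex mat \<Rightarrow> nat list \<Rightarrow> ((nat \<Rightarrow> bool) \<Rightarrow> complex) \<Rightarrow> (nat \<Rightarrow> bool) \<Rightarrow> complex" where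
  "apply_gate M qs f b = (\<Sum>bs | length bs = length qs.
      M $$ (bits_index (map b qs), bits_index bs) * f (upd_wires b qs bs))"

definition run_circuit ::
  "circuit \<Rightarrow> ((nat \<Rightarrow> bool) \<Rightarrow> complex) \<Rightarrow> (nat \<Rightarrow> bool) \<Rightarrow> complex" where
  "run_circuit C f = fold (\<lambda>(M, qs). apply_gate M qs) C f"

definition amp_vec :: "nat \<Rightarrow> ((nat \<Rightarrow> bool) \<Rightarrow> complex) \<Rightarrow> complex vec" where
  "amp_vec N f = vec (2 ^ N) (\<lambda>i. f (vals N i))"

definition bits_fun :: "bool list \<Rightarrow> nat \<Rightarrow> bool" where
  "bits_fun y q \<longleftrightarrow> q < length y \<and> y ! q"

definition basis_state :: "bool list \<Rightarrow> (nat \<Rightarrow> bool) \<Rightarrow> complex" where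
  "basis_state y b = of_bool (b = bits_fun y)"

lemma run_circuit_simps [simp]:
  "run_circuit [] f = f"
  "run_circuit ((M, qs) # C) f = run_circuit C (apply_gate M qs f)"
  "run_circuit (C @ D) f = run_circuit D (run_circuit C f)"
  by (simp_all add: run_circuit_def)

lemma finite_lists_length [simp]: "finite {bs :: bool list. length bs = k}"
  using finite_lists_length_eq[of "UNIV :: bool set" k] by simp

lemma bits_index_less: "bits_index bs < 2 ^ length bs"
  unfolding bits_index_def by (metis horner_sum_of_bool_2_less length_rev)

lemma bit_bits_index: "bit (bits_index bs) j \<longleftrightarrow> j < length bs \<and> bs ! (length bs - 1 - j)"
  unfolding bits_index_def by (auto simp: bit_horner_sum_bit_iff rev_nth)

lemma vals_bits_index:
  assumes "length bs = N"
  shows "vals N (bits_index bs) = bits_fun bs"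
  using assms by (auto simp: fun_eq_iff vals_def qubit_val_def bits_fun_def bit_bits_index)

lemma bits_fun_map: "bits_fun (map b [0..<N]) = (\<lambda>q. q < N \<and> b q)"
  by (auto simp: fun_eq_iff bits_fun_def)

lemma map_bits_fun:
  assumes "length y = k"
  shows "map (bits_fun y) [0..<k] = y"
  using assms by (intro nth_equalityI) (auto simp: bits_fun_def)

lemma bits_index_vals:
  assumes "i < 2 ^ N"
  shows "bits_index (map (qubit_val N i) [0..<N]) = i"
proof (rule bit_eqI)
  fix j
  have "bit i j \<Longrightarrow> j < N"
    using assms by (metis bit_take_bit_iff take_bit_nat_eq_self)
  then show "bit (bits_index (map (qubit_val N i) [0..<N])) j = bit i j"
    by (auto simp: bit_bits_index qubit_val_def)
qed

lemma vals_inject: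
  assumes "i < 2 ^ N" "j < 2 ^ N" "vals N i = vals N j"
  shows "i = j"
proof -
  have "qubit_val N i q = qubit_val N j q" if "q < N" for q
    using fun_cong[OF assms(3), of q] that by (simp add: vals_def)
  then have "map (qubit_val N i) [0..<N] = map (qubit_val N j) [0..<N]"
    by simp
  then have "bits_index (map (qubit_val N i) [0..<N]) = bits_index (map (qubit_val N j) [0..<N])"
    by (rule arg_cong)
  then show ?thesis unfolding bits_index_vals[OF assms(1)] bits_index_vals[OF assms(2)] .
qed

lemma upd_wires_notin: "q \<notin> set qs \<Longrightarrow> upd_wires b qs bs q = b q"
  by (auto simp: upd_wires_def split: option.splits dest: map_of_SomeD set_zip_leftD)

lemma upd_wires_nth:
  "\<lbrakk>distinct qs; length bs = length qs; j < length qs\<rbrakk> \<Longrightarrow> upd_wires b qs bs (qs ! j) = bs ! j"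
  by (simp add: upd_wires_def map_of_zip_nth)

lemma map_upd_wires:
  "\<lbrakk>distinct qs; length bs = length qs\<rbrakk> \<Longrightarrow> map (upd_wires b qs bs) qs = bs"
  by (intro nth_equalityI) (auto simp: upd_wires_nth)

lemma upd_wires_eqI:
  assumes "distinct qs" "\<And>q. q \<notin> set qs \<Longrightarrow> b' q = b q"
  shows "upd_wires b qs (map b' qs) = b'"
proof
  fix q
  show "upd_wires b qs (map b' qs) q = b' q"
  proof (cases "q \<in> set qs")
    case True
    then obtain j where "j < length qs" "q = qs ! j" by (auto simp: in_set_conv_nth)
    then show ?thesis using assms(1) by (simp add: upd_wires_nth)
  qed (simp add: upd_wires_notin assms)
qed

section \<open>From matrices on \<open>N\<close> qubits to maps of amplitude functions\<close>

lemma gate_on_carrier [simp]: "gate_on N g \<in> carrier_mat (2 ^ N) (2 ^ N)"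
  by (cases g) (simp add: gate_on_def)

lemma circuit_mat_carrier [simp]: "circuit_mat N C \<in> carrier_mat (2 ^ N) (2 ^ N)"
  by (induction C) (auto intro: mult_carrier_mat)

lemma amp_vec_carrier [simp]: "amp_vec N f \<in> carrier_vec (2 ^ N)"
  by (simp add: amp_vec_def)

text \<open>Row \<open>i\<close> of \<open>gate_on\<close> can be nonzero only in columns that agree
  with \<open>i\<close> off \<open>qs\<close>, and these correspond to the bit lists on
  \<open>qs\<close>; the matrix-vector sum is reindexed along this bijection.\<close>

lemma gate_on_amp_vec:
  assumes "distinct qs" "set qs \<subseteq> {..<N}"
  shows "gate_on N (M, qs) *\<^sub>v amp_vec N f = amp_vec N (apply_gate M qs f)"
proof (rule eq_vecI)
  fix i assume "i < dim_vec (amp_vec N (apply_gate M qs f))"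
  then have i: "i < 2 ^ N" by (simp add: amp_vec_def)
  define agree where
    "agree j \<longleftrightarrow> (\<forall>q<N. q \<notin> set qs \<longrightarrow> qubit_val N i q = qubit_val N j q)" for j
  let ?w = "\<lambda>bs. bits_index (map (upd_wires (vals N i) qs bs) [0..<N])"
  have mv: "map (vals N j) qs = map (qubit_val N j) qs" for j
    using assms(2) by (auto simp: vals_def)
  have vw: "vals N (?w bs) = upd_wires (vals N i) qs bs" for bs
  proof -
    have "\<not> upd_wires (vals N i) qs bs q" if "\<not> q < N" for q
      using that assms(2) by (subst upd_wires_notin) (auto simp: vals_def)
    then show ?thesis
      by (subst vals_bits_index, simp) (auto simp: bits_fun_map)
  qed
  have "(gate_on N (M, qs) *\<^sub>v amp_vec N f) $ i =
      (\<Sum>j = 0..<2 ^ N. (if agree j then M $$ (bits_index (map (qubit_val N i) qs),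
          bits_index (map (qubit_val N j) qs)) else 0) * f (vals N j))"
    using i by (simp add: gate_on_def amp_vec_def scalar_prod_def agree_def)
  also have "\<dots> = (\<Sum>j \<in> {j. j < 2 ^ N \<and> agree j}. M $$ (bits_index (map (qubit_val N i) qs),
          bits_index (map (qubit_val N j) qs)) * f (vals N j))"
    by (rule sum.mono_neutral_cong_right) auto
  also have "\<dots> = (\<Sum>bs | length bs = length qs. M $$ (bits_index (map (qubit_val N i) qs),
          bits_index bs) * f (upd_wires (vals N i) qs bs))"
  proof (rule sum.reindex_bij_witness[where i = ?w and j = "\<lambda>j. map (qubit_val N j) qs"])
    fix j assume j: "j \<in> {j. j < 2 ^ N \<and> agree j}"
    have u: "upd_wires (vals N i) qs (map (qubit_val N j) qs) = vals N j"
      unfolding mv[symmetric] using assms(1) j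
      by (intro upd_wires_eqI) (auto simp: agree_def vals_def)
    have "vals N (?w (map (qubit_val N j) qs)) = vals N j"
      unfolding vw by (rule u)
    then show "?w (map (qubit_val N j) qs) = j"
      using vals_inject j bits_index_less
      by (metis (no_types, lifting) length_map length_upt minus_nat.diff_0 mem_Collect_eq)
    show "M $$ (bits_index (map (qubit_val N i) qs), bits_index (map (qubit_val N j) qs)) *
        f (upd_wires (vals N i) qs (map (qubit_val N j) qs)) =
        M $$ (bits_index (map (qubit_val N i) qs), bits_index (map (qubit_val N j) qs)) *
        f (vals N j)" using u by simp
  next
    fix bs :: "bool list" assume bs: "bs \<in> {bs. length bs = length qs}"
    show "map (qubit_val N (?w bs)) qs = bs"
      unfolding mv[symmetric] vw using bs assms(1) by (simp add: map_upd_wires)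
    have "agree (?w bs)"
      unfolding agree_def
    proof (intro allI impI)
      fix q assume q: "q < N" "q \<notin> set qs"
      have "vals N (?w bs) q = vals N i q" using q vw by (simp add: upd_wires_notin)
      then show "qubit_val N i q = qubit_val N (?w bs) q" using q by (simp add: vals_def)
    qed
    moreover have "?w bs < 2 ^ N" 
      using bits_index_less[of "map (upd_wires (vals N i) qs bs) [0..<N]"] by simp
    ultimately show "?w bs \<in> {j. j < 2 ^ N \<and> agree j}" by simp
  qed simp
  also have "\<dots> = amp_vec N (apply_gate M qs f) $ i"
    using i by (simp add: amp_vec_def apply_gate_def mv)
  finally show "(gate_on N (M, qs) *\<^sub>v amp_vec N f) $ i = amp_vec N (apply_gate M qs f) $ i" .
qed (simp add: amp_vec_def gate_on_def)

lemma circuit_mat_amp_vec: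
  assumes "\<forall>(M, qs)\<in>set C. distinct qs \<and> set qs \<subseteq> {..<N}"
  shows "circuit_mat N C *\<^sub>v amp_vec N f = amp_vec N (run_circuit C f)"
  using assms
proof (induction C arbitrary: f)
  case Nil
  then show ?case by simp
next
  case (Cons g C)
  obtain M qs where g: "g = (M, qs)" by force
  have "circuit_mat N (g # C) *\<^sub>v amp_vec N f =
      circuit_mat N C *\<^sub>v (gate_on N g *\<^sub>v amp_vec N f)"
    by (simp add: assoc_mult_mat_vec[of _ "2 ^ N" "2 ^ N" _ "2 ^ N"])
  then show ?case
    using Cons by (simp add: g gate_on_amp_vec)
qed

lemma ket_eq_amp_vec: "ket y = amp_vec (length y) (basis_state y)"
proof (rule eq_vecI)
  fix i assume "i < dim_vec (amp_vec (length y) (basis_state y))"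
  then have i: "i < 2 ^ length y" by (simp add: amp_vec_def)
  have "i = bits_index y \<longleftrightarrow> vals (length y) i = bits_fun y"
    using vals_inject[OF i bits_index_less] vals_bits_index[of y] by metis
  then show "ket y $ i = amp_vec (length y) (basis_state y) $ i"
    using i bits_index_less by (simp add: ket_def amp_vec_def basis_state_def unit_vec_def)
qed (simp add: ket_def amp_vec_def)

text \<open>Big-endian order makes the second factor the low bits: the remainder of \<open>i\<close>
  holds the wires from \<open>n\<close> on, the quotient those below \<open>n\<close>.\<close>

lemma tensor_amp_vec_ket:
  "amp_vec n f \<otimes>\<^sub>v ket z = amp_vec (n + length z)
     (\<lambda>b. if \<forall>q<length z. b (n + q) = z ! q then f (\<lambda>q. q < n \<and> b q) else 0)"
  (is "_ = amp_vec _ ?h")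
proof (rule eq_vecI)
  let ?k = "length z"
  fix i assume "i < dim_vec (amp_vec (n + ?k) ?h)"
  then have i: "i < 2 ^ (n + ?k)" by (simp add: amp_vec_def)
  have d: "i div 2 ^ ?k < 2 ^ n"
    using i by (simp add: power_add less_mult_imp_div_less)
  have v1: "vals n (i div 2 ^ ?k) = (\<lambda>q. q < n \<and> vals (n + ?k) i q)"
    by (auto simp: fun_eq_iff vals_def qubit_val_def bit_drop_bit_eq add.commute simp flip: drop_bit_eq_div)
  have v2: "vals ?k (i mod 2 ^ ?k) = (\<lambda>q. q < ?k \<and> vals (n + ?k) i (n + q))"
    by (auto simp: fun_eq_iff vals_def qubit_val_def bit_take_bit_iff simp flip: take_bit_eq_mod)
  have L: "(amp_vec n f \<otimes>\<^sub>v ket z) $ i =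
      f (vals n (i div 2 ^ ?k)) * (if i mod 2 ^ ?k = bits_index z then 1 else 0)"
    using i d bits_index_less[of z]
    by (simp add: tensor_vec_def amp_vec_def ket_def unit_vec_def power_add)
  have "i mod 2 ^ ?k = bits_index z \<longleftrightarrow> vals ?k (i mod 2 ^ ?k) = bits_fun z"
    using vals_inject[of "i mod 2 ^ ?k", OF _ bits_index_less] vals_bits_index[of z] by auto
  also have "\<dots> \<longleftrightarrow> (\<forall>q<?k. vals (n + ?k) i (n + q) = z ! q)"
    unfolding v2 by (auto simp: fun_eq_iff bits_fun_def)
  finally show "(amp_vec n f \<otimes>\<^sub>v ket z) $ i = amp_vec (n + ?k) ?h $ i"
    unfolding L v1 using i by (auto simp: amp_vec_def)
qed (simp add: tensor_vec_def amp_vec_def ket_def power_add)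

lemma ket_append: "ket y \<otimes>\<^sub>v ket z = ket (y @ z)"
proof -
  let ?n = "length y" and ?k = "length z"
  have "(\<forall>q<?k. b (?n + q) = z ! q) \<and> (\<lambda>q. q < ?n \<and> b q) = bits_fun y \<longleftrightarrow> b = bits_fun (y @ z)"
    if b: "\<And>q. q \<ge> ?n + ?k \<Longrightarrow> \<not> b q" for b
  proof (rule iffI, rule ext)
    fix q assume *: "(\<forall>q<?k. b (?n + q) = z ! q) \<and> (\<lambda>q. q < ?n \<and> b q) = bits_fun y"
    consider "q < ?n" | r where "q = ?n + r" "r < ?k" | "q \<ge> ?n + ?k"
      by (metis le_add_diff_inverse nat_add_left_cancel_less not_le_imp_less)
    then show "b q = bits_fun (y @ z) q"
    proof cases
      case 1
      then show ?thesis using fun_cong[OF conjunct2[OF *], of q]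
        by (simp add: bits_fun_def nth_append)
    next
      case 2
      then show ?thesis using * by (simp add: bits_fun_def)
    qed (use b in \<open>simp add: bits_fun_def\<close>)
  qed (auto simp: bits_fun_def nth_append)
  note this[of "vals (?n + ?k) i" for i]
  then have key: "vals (?n + ?k) i = bits_fun (y @ z) \<longleftrightarrow> (\<forall>q<?k. vals (?n + ?k) i (?n + q) = z ! q) \<and>
      (\<lambda>q. q < ?n \<and> vals (?n + ?k) i q) = bits_fun y" for i
    by (metis (no_types, lifting) vals_def not_less)
  have "(if \<forall>q<?k. vals (?n + ?k) i (?n + q) = z ! q
           then basis_state y (\<lambda>q. q < ?n \<and> vals (?n + ?k) i q) else 0) =
        basis_state (y @ z) (vals (?n + ?k) i)" for i
    unfolding basis_state_def key by simp
  then show ?thesis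
    unfolding ket_eq_amp_vec[of y] tensor_amp_vec_ket ket_eq_amp_vec[of "y @ z"] length_append
    by (simp add: amp_vec_def)
qed

text \<open>The reason for working with amplitude functions: clean ancillas leave the state
  literally unchanged.\<close>

lemma basis_state_append_zeros: "basis_state (y @ replicate a False) = basis_state y"
proof -
  have "bits_fun (y @ replicate a False) = bits_fun y"
    by (auto simp: fun_eq_iff bits_fun_def nth_append)
  then show ?thesis by (simp add: fun_eq_iff basis_state_def)
qed

lemma gate_on_all:
  assumes "V \<in> carrier_mat (2 ^ k) (2 ^ k)"
  shows "gate_on k (V, [0..<k]) = V"
  using assms by (intro eq_matI) (auto simp: gate_on_def bits_index_vals)

section \<open>Relabelling of wires, linearity and locality\<close>

definition relabel :: "(nat \<Rightarrow> nat) \<Rightarrow> circuit \<Rightarrow> circuit" where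
  "relabel \<eta> C = map (\<lambda>(M, qs). (M, map \<eta> qs)) C"

definition wires :: "circuit \<Rightarrow> nat set" where
  "wires C = (\<Union>(M, qs)\<in>set C. set qs)"

lemma relabel_simps [simp]:
  "relabel \<eta> [] = []" "relabel \<eta> ((M, qs) # C) = (M, map \<eta> qs) # relabel \<eta> C"
  "relabel \<eta> (C @ D) = relabel \<eta> C @ relabel \<eta> D"
  by (simp_all add: relabel_def)

lemma wires_simps [simp]:
  "wires [] = {}" "wires ((M, qs) # C) = set qs \<union> wires C" "wires (C @ D) = wires C \<union> wires D"
  by (auto simp: wires_def)

lemma wires_relabel: "wires (relabel \<eta> C) = \<eta> ` wires C"
  by (induction C) auto

lemma run_circuit_sum:
  "run_circuit C (\<lambda>b. \<Sum>y\<in>Y. c y * g y b) = (\<lambda>b. \<Sum>y\<in>Y. c y * run_circuit C (g y) b)"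
proof (induction C arbitrary: g)
  case (Cons h C)
  obtain M qs where h: "h = (M, qs)" by force
  have "apply_gate M qs (\<lambda>b. \<Sum>y\<in>Y. c y * g y b) = (\<lambda>b. \<Sum>y\<in>Y. c y * apply_gate M qs (g y) b)"
    unfolding apply_gate_def sum_distrib_left by (subst sum.swap) (simp add: mult_ac)
  then show ?case using Cons by (simp add: h)
qed simp

lemma upd_wires_map:
  assumes "inj \<eta>" "length bs = length qs"
  shows "upd_wires b (map \<eta> qs) bs \<circ> \<eta> = upd_wires (b \<circ> \<eta>) qs bs"
proof -
  have "map_of (zip (map \<eta> qs) bs) (\<eta> q) = map_of (zip qs bs) q" for q
    using assms(2)[symmetric] by (induction qs bs rule: list_induct2) (auto simp: inj_eq[OF assms(1)])
  then show ?thesis by (simp add: fun_eq_iff upd_wires_def comp_def)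
qed

text \<open>The factor \<open>\<chi>\<close> is a spectator: it depends only on wires outside
  \<open>range \<eta>\<close>, which no relabelled gate touches. Constant \<open>\<chi>\<close>
  gives that circuits commute with renaming wires; otherwise it splits off the encoding
  qubits.\<close>

lemma run_circuit_relabel:
  assumes \<eta>: "inj \<eta>" and \<chi>: "\<And>b b'. (\<And>q. q \<notin> range \<eta> \<Longrightarrow> b q = b' q) \<Longrightarrow> \<chi> b = \<chi> b'"
  shows "run_circuit (relabel \<eta> C) (\<lambda>b. h (b \<circ> \<eta>) * \<chi> b) = (\<lambda>b. run_circuit C h (b \<circ> \<eta>) * \<chi> b)"
proof (induction C arbitrary: h)
  case (Cons g C)
  obtain M qs where g: "g = (M, qs)" by force
  have "apply_gate M (map \<eta> qs) (\<lambda>b. h (b \<circ> \<eta>) * \<chi> b) b = apply_gate M qs h (b \<circ> \<eta>) * \<chi> b" for b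
  proof -
    have "\<chi> (upd_wires b (map \<eta> qs) bs) = \<chi> b" for bs
      by (rule \<chi>) (rule upd_wires_notin, auto)
    then show ?thesis
      unfolding apply_gate_def sum_distrib_right
      by (intro sum.cong) (auto simp: upd_wires_map[OF \<eta>])
  qed
  then have "apply_gate M (map \<eta> qs) (\<lambda>b. h (b \<circ> \<eta>) * \<chi> b) =
      (\<lambda>b. apply_gate M qs h (b \<circ> \<eta>) * \<chi> b)" by blast
  then show ?case using Cons[of "apply_gate M qs h"]
    by (simp only: g relabel_simps run_circuit_simps)
qed simp

text \<open>Gates on wires in \<open>W\<close> only mix assignments that agree off \<open>W\<close>,
  so each class of such assignments evolves by itself.\<close>

lemma run_circuit_local:
  assumes "wires C \<subseteq> W"
    and "\<And>b'. (\<And>q. q \<notin> W \<Longrightarrow> b' q = b q) \<Longrightarrow> f b' = g b'"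
    and "\<And>q. q \<notin> W \<Longrightarrow> b' q = b q"
  shows "run_circuit C f b' = run_circuit C g b'"
  using assms
proof (induction C arbitrary: f g b')
  case Nil
  then show ?case using Nil.prems(2)[OF Nil.prems(3)] by simp
next
  case (Cons h C)
  obtain M qs where h: "h = (M, qs)" by force
  have qs: "set qs \<subseteq> W" using Cons.prems(1) by (simp add: h)
  have "apply_gate M qs f b1 = apply_gate M qs g b1" if "\<And>q. q \<notin> W \<Longrightarrow> b1 q = b q" for b1
  proof -
    have "f (upd_wires b1 qs bs) = g (upd_wires b1 qs bs)" for bs
      using that qs by (intro Cons.prems(2)) (metis subset_iff upd_wires_notin)
    then show ?thesis by (simp add: apply_gate_def)
  qed
  then have "run_circuit C (apply_gate M qs f) b' = run_circuit C (apply_gate M qs g) b'"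
    using Cons.prems by (intro Cons.IH) (auto simp: h)
  then show ?case by (simp add: h)
qed

text \<open>Untouched wires keep their value: this carries clean ancillas and control bits through a
  circuit. If \<open>Q b\<close> fails, it fails on all assignments agreeing with \<open>b\<close>
  off \<open>W\<close>, and \<open>f\<close> vanishes there.\<close>

lemma run_circuit_support:
  fixes f :: "(nat \<Rightarrow> bool) \<Rightarrow> complex" and b :: "nat \<Rightarrow> bool"
  assumes "wires C \<subseteq> W"
    and Q: "\<And>b b'. (\<And>q. q \<notin> W \<Longrightarrow> b q = b' q) \<Longrightarrow> Q b \<Longrightarrow> Q b'"
    and "\<And>b. f b \<noteq> 0 \<Longrightarrow> Q b"
    and "run_circuit C f b \<noteq> 0"
  shows "Q b"
proof (rule ccontr)
  assume nQ: "\<not> Q b"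
  have "run_circuit C f b = run_circuit C (\<lambda>_. 0) b"
  proof (rule run_circuit_local[OF assms(1)])
    fix b' :: "nat \<Rightarrow> bool" assume "\<And>q. q \<notin> W \<Longrightarrow> b' q = b q"
    then have "\<not> Q b'" using nQ Q by blast
    then show "f b' = 0" using assms(3) by auto
  qed simp
  also have "run_circuit C (\<lambda>_. 0) = (\<lambda>_. 0)"
  proof (induction C)
    case (Cons h C)
    have "apply_gate M qs (\<lambda>_. 0) = (\<lambda>_. 0)" for M qs by (simp add: apply_gate_def fun_eq_iff)
    then show ?case using Cons by (cases h) simp
  qed simp
  finally show False using assms(4) by simp
qed

text \<open>
  Only wires \<open>\<rho> j\<close> with \<open>j < k\<close> may be nonzero on the support of \<open>f\<close>, so the wires \<open>\<rho> j\<close> with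
  \<open>j \<ge> k\<close> play the role of clean ancillas.
\<close>

lemma run_circuit_eq_from_basis:
  assumes \<rho>: "inj \<rho>"
    and eq: "\<And>y. length y = k \<Longrightarrow> run_circuit C (basis_state y) = run_circuit C' (basis_state y)"
    and f: "\<And>b j. f b \<noteq> 0 \<Longrightarrow> k \<le> j \<Longrightarrow> \<not> b (\<rho> j)"
  shows "run_circuit (relabel \<rho> C) f = run_circuit (relabel \<rho> C') f"
proof
  fix b
  \<comment> \<open>\<open>e y\<close> is \<open>b\<close> with the wires in
    \<open>range \<rho>\<close> overwritten by \<open>y\<close>. On the assignments that agree with
    \<open>b\<close> off this range, \<open>f\<close> is the combination \<open>g\<close> of basis
    states with coefficients \<open>f (e y)\<close>; the \<open>y\<close> of length \<open>k\<close>
    suffice because \<open>f\<close> vanishes once a wire \<open>\<rho> j\<close> with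
    \<open>j \<ge> k\<close> is set. Linearity then reduces the claim to basis states.\<close>
  define e where "e y q = (if q \<in> range \<rho> then bits_fun y (inv_into UNIV \<rho> q) else b q)" for y q
  define \<chi> :: "(nat \<Rightarrow> bool) \<Rightarrow> complex" where
    "\<chi> b' = of_bool (\<forall>q. q \<notin> range \<rho> \<longrightarrow> b' q = b q)" for b'
  define g where "g b' = (\<Sum>y | length y = k. f (e y) * (basis_state y (b' \<circ> \<rho>) * \<chi> b'))" for b'
  have fg: "f b' = g b'" if b': "\<And>q. q \<notin> range \<rho> \<Longrightarrow> b' q = b q" for b'
  proof -
    have \<chi>: "\<chi> b' = 1" using b' by (simp add: \<chi>_def)
    define y0 where "y0 = map (b' \<circ> \<rho>) [0..<k]"
    show ?thesis
    proof (cases "\<exists>j\<ge>k. b' (\<rho> j)")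
      case True
      then obtain j where j: "j \<ge> k" "b' (\<rho> j)" by blast
      have "basis_state y (b' \<circ> \<rho>) = 0" if "length y = k" for y
      proof -
        have "(b' \<circ> \<rho>) j \<noteq> bits_fun y j" using j that by (simp add: bits_fun_def)
        then have "b' \<circ> \<rho> \<noteq> bits_fun y" by metis
        then show ?thesis by (simp add: basis_state_def)
      qed
      then have "g b' = 0" by (simp add: g_def)
      then show ?thesis using f j by fastforce
    next
      case False
      then have "b' (\<rho> j) \<Longrightarrow> j < k" for j using not_less by blast
      then have by0: "b' \<circ> \<rho> = bits_fun y0"
        unfolding y0_def bits_fun_map by (auto simp: fun_eq_iff)
      have "e y0 = b'"
      proof
        fix q show "e y0 q = b' q"
        proof (cases "q \<in> range \<rho>")
          case True
          then obtain j where q: "q = \<rho> j" by blast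
          then show ?thesis using fun_cong[OF by0, of j] \<rho> by (simp add: e_def)
        qed (simp add: e_def b')
      qed
      moreover have "basis_state y (b' \<circ> \<rho>) = of_bool (y = y0)" if "length y = k" for y
      proof -
        have "length y0 = k" by (simp add: y0_def)
        then have "bits_fun y0 = bits_fun y \<longleftrightarrow> y = y0" using that map_bits_fun by metis
        then show ?thesis by (simp add: basis_state_def by0)
      qed
      ultimately have "g b' = (\<Sum>y | length y = k. if y = y0 then f b' else 0)"
        unfolding g_def by (intro sum.cong) (auto simp: \<chi>)
      also have "\<dots> = f b'" by (simp add: y0_def)
      finally show ?thesis by simp
    qed
  qed
  have run: "run_circuit (relabel \<rho> X) f b =
      (\<Sum>y | length y = k. f (e y) * (run_circuit X (basis_state y) (b \<circ> \<rho>) * \<chi> b))" for X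
  proof -
    have "run_circuit (relabel \<rho> X) f b = run_circuit (relabel \<rho> X) g b"
      by (rule run_circuit_local[where W = "range \<rho>" and b = b])
        (auto simp: wires_relabel intro: fg)
    also have "\<dots> = (\<Sum>y | length y = k. f (e y) *
        run_circuit (relabel \<rho> X) (\<lambda>b'. basis_state y (b' \<circ> \<rho>) * \<chi> b') b)"
      unfolding g_def run_circuit_sum ..
    also have "\<dots> = (\<Sum>y | length y = k. f (e y) * (run_circuit X (basis_state y) (b \<circ> \<rho>) * \<chi> b))"
      by (subst run_circuit_relabel[OF \<rho>]) (auto simp: \<chi>_def)
    finally show ?thesis .
  qed
  show "run_circuit (relabel \<rho> C) f b = run_circuit (relabel \<rho> C') f b"
    unfolding run using eq by (intro sum.cong) auto
qed

lemma amp_vec_eqD: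
  assumes "amp_vec N f = amp_vec N g" "\<And>q. q \<ge> N \<Longrightarrow> \<not> b q"
  shows "f b = g b"
proof -
  let ?i = "bits_index (map b [0..<N])"
  have i: "?i < 2 ^ N" using bits_index_less[of "map b [0..<N]"] by simp
  have "b q \<Longrightarrow> q < N" for q using assms(2) not_less by blast
  then have "vals N ?i = b"
    by (subst vals_bits_index, simp) (auto simp: bits_fun_map fun_eq_iff)
  then show ?thesis
    using i arg_cong[OF assms(1), of "\<lambda>v. v $ ?i"] by (simp add: amp_vec_def)
qed

lemma run_circuit_basis_zero:
  assumes "run_circuit C (basis_state y) b \<noteq> 0" "wires C \<subseteq> {..<N}" "length y \<le> N" "q \<ge> N"
  shows "\<not> b q"
proof -
  have "\<forall>q\<ge>N. \<not> b q"
  proof (rule run_circuit_support[OF assms(2) _ _ assms(1)])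
    fix b assume "basis_state y b \<noteq> 0"
    then show "\<forall>q\<ge>N. \<not> b q" using assms(3) by (auto simp: basis_state_def bits_fun_def)
  qed (auto simp: not_less)
  then show ?thesis using assms(4) by blast
qed

lemma circuit_over_wires: "circuit_over G N C \<Longrightarrow> wires C \<subseteq> {..<N}"
  unfolding circuit_over_def wires_def by fast

lemma circuit_over_amp_vec:
  assumes "circuit_over G N C"
  shows "circuit_mat N C *\<^sub>v amp_vec N f = amp_vec N (run_circuit C f)"
  using assms by (intro circuit_mat_amp_vec) (auto simp: circuit_over_def)

text \<open>Removes the ancillas from \<open>implements\<close>: amplitude functions do not see
  wires in state zero, and the run of \<open>V\<close> vanishes wherever a wire from
  \<open>k\<close> on is set. Inside the register the matrix identity decides, beyond it both sides
  vanish.\<close>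

lemma implements_run_circuit:
  assumes impl: "implements k a C V" and V: "V \<in> carrier_mat (2 ^ k) (2 ^ k)"
    and C: "circuit_over G (k + a) C" and y: "length y = k"
  shows "run_circuit C (basis_state y) = run_circuit [(V, [0..<k])] (basis_state y)"
proof
  fix b
  let ?V = "[(V, [0..<k])]"
  have "V *\<^sub>v ket y = amp_vec k (run_circuit ?V (basis_state y))"
    using gate_on_amp_vec[of "[0..<k]" k V "basis_state y"] y
    by (simp add: gate_on_all[OF V] ket_eq_amp_vec lessThan_atLeast0)
  moreover have "ket y \<otimes>\<^sub>v ket (replicate a False) = amp_vec (k + a) (basis_state y)"
    by (simp add: ket_append ket_eq_amp_vec[of "y @ replicate a False"] y basis_state_append_zeros)
  ultimately have "amp_vec (k + a) (run_circuit C (basis_state y)) =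
      amp_vec k (run_circuit ?V (basis_state y)) \<otimes>\<^sub>v ket (replicate a False)"
    using impl y circuit_over_amp_vec[OF C] unfolding implements_def by metis
  also have "\<dots> = amp_vec (k + a) (\<lambda>b. if \<forall>q<a. \<not> b (k + q)
      then run_circuit ?V (basis_state y) (\<lambda>q. q < k \<and> b q) else 0)"
    unfolding tensor_amp_vec_ket by (intro arg_cong2[of _ _ _ _ amp_vec]) auto
  finally have eq: "amp_vec (k + a) (run_circuit C (basis_state y)) = \<dots>" .
  have V0: "run_circuit ?V (basis_state y) b = 0" if "q \<ge> k" "b q" for q
    using run_circuit_basis_zero[of ?V y b k q] that y by (auto simp: lessThan_atLeast0)
  show "run_circuit C (basis_state y) b = run_circuit ?V (basis_state y) b"
  proof (cases "\<exists>q\<ge>k + a. b q")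
    case True
    then obtain q where q: "q \<ge> k + a" "b q" by blast
    then have "run_circuit C (basis_state y) b = 0"
      using run_circuit_basis_zero[OF _ circuit_over_wires[OF C], of y b q] y by auto
    then show ?thesis using V0[of q] q by simp
  next
    case False
    note b = amp_vec_eqD[OF eq, of b]
    show ?thesis
    proof (cases "\<forall>q<a. \<not> b (k + q)")
      case True
      have "(\<lambda>q. q < k \<and> b q) = b"
      proof
        fix q show "(q < k \<and> b q) = b q"
          using True[rule_format, of "q - k"] False by (cases "q < k"; cases "q < k + a") auto
      qed
      then show ?thesis using b False True by auto
    next
      case c: False
      then obtain q where q: "b (k + q)" by blast
      then show ?thesis using V0[of "k + q"] b False c by auto
    qed
  qed
qed

section \<open>Controlled gates and swaps on amplitude functions\<close>

lemma bits_index_inject: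
  assumes "length xs = length ys"
  shows "bits_index xs = bits_index ys \<longleftrightarrow> xs = ys"
proof
  assume "bits_index xs = bits_index ys"
  then have "bits_fun xs = bits_fun ys"
    using vals_bits_index[of xs "length xs"] vals_bits_index[of ys "length xs"] assms by simp
  then show "xs = ys" using map_bits_fun[of xs "length xs"] map_bits_fun[of ys "length xs"] assms
    by simp
qed simp

lemma bits_index_Cons: "bits_index (c # bs) = of_bool c * 2 ^ length bs + bits_index bs"
  by (simp add: bits_index_def horner_sum_append)

lemma lists_Suc_length:
  "{bs :: bool list. length bs = Suc k} = (#) True ` {bs. length bs = k} \<union> (#) False ` {bs. length bs = k}"
  by (auto simp: length_Suc_conv image_iff)

lemma sum_lists_Suc:
  "(\<Sum>bs | length bs = Suc k. F bs) = (\<Sum>bs | length bs = k. F (True # bs)) +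
     (\<Sum>bs | length bs = k. F (False # bs))" for F :: "bool list \<Rightarrow> complex"
  unfolding lists_Suc_length
  by (subst sum.union_disjoint) (auto simp: sum.reindex inj_on_def)

lemma upd_wires_Cons: "upd_wires b (w # qs) (c # bs) = (upd_wires b qs bs)(w := c)"
  by (auto simp: fun_eq_iff upd_wires_def)

text \<open>A control in front is the most significant bit, so splitting the column sum by it meets
  one diagonal block of \<open>controlled M\<close> and one zero block. The identity block leaves
  the single term \<open>bs = map b qs\<close>.\<close>

lemma apply_gate_controlled:
  assumes M: "M \<in> carrier_mat (2 ^ length qs) (2 ^ length qs)" and d: "distinct (w # qs)"
  shows "apply_gate (controlled M) (w # qs) f b = (if b w then apply_gate M qs f b else f b)"
proof -
  let ?k = "length qs"
  let ?i = "bits_index (map b qs)"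
  have i: "?i < 2 ^ ?k" using bits_index_less[of "map b qs"] by simp
  have j: "bits_index bs < 2 ^ ?k" if "length bs = ?k" for bs
    using bits_index_less[of bs] that by simp
  have j2: "bits_index bs < 2 ^ ?k + 2 ^ ?k" if "length bs = ?k" for bs
    using j[OF that] by simp
  have dim: "dim_row M = 2 ^ ?k" "dim_col M = 2 ^ ?k" using M by auto
  have upd: "(upd_wires b qs bs)(w := b w) = upd_wires b qs bs" for bs
    using d by (auto simp: fun_eq_iff upd_wires_notin)
  show ?thesis
  proof (cases "b w")
    case True
    have "(\<Sum>bs | length bs = ?k. controlled M $$ (bits_index (map b (w # qs)), bits_index (True # bs)) *
        f (upd_wires b (w # qs) (True # bs))) = apply_gate M qs f b"
      unfolding apply_gate_def using i j j2 True upd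
      by (intro sum.cong) (auto simp: controlled_def bits_index_Cons dim upd_wires_Cons)
    moreover have "(\<Sum>bs | length bs = ?k. controlled M $$
        (bits_index (map b (w # qs)), bits_index (False # bs)) *
        f (upd_wires b (w # qs) (False # bs))) = 0"
      using i j j2 True
      by (intro sum.neutral) (auto simp: controlled_def bits_index_Cons dim)
    ultimately show ?thesis
      using True unfolding apply_gate_def[of "controlled M"] length_Cons sum_lists_Suc by simp
  next
    case False
    have "(\<Sum>bs | length bs = ?k. controlled M $$ (bits_index (map b (w # qs)), bits_index (False # bs)) *
        f (upd_wires b (w # qs) (False # bs))) =
        (\<Sum>bs | length bs = ?k. if bs = map b qs then f (upd_wires b qs bs) else 0)"
      using i j j2 False upd
      by (intro sum.cong)
        (auto simp: controlled_def bits_index_Cons dim upd_wires_Cons bits_index_inject)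
    moreover have "(\<Sum>bs | length bs = ?k. controlled M $$
        (bits_index (map b (w # qs)), bits_index (True # bs)) *
        f (upd_wires b (w # qs) (True # bs))) = 0"
      using i j j2 False
      by (intro sum.neutral) (auto simp: controlled_def bits_index_Cons dim)
    ultimately have "apply_gate (controlled M) (w # qs) f b =
        (\<Sum>bs | length bs = ?k. if bs = map b qs then f (upd_wires b qs bs) else 0)"
      unfolding apply_gate_def length_Cons sum_lists_Suc by simp
    also have "\<dots> = f (upd_wires b qs (map b qs))" by simp
    also have "upd_wires b qs (map b qs) = b" using d by (intro upd_wires_eqI) auto
    finally show ?thesis using False by simp
  qed
qed

lemma apply_gate_swap:
  assumes "u \<noteq> v"
  shows "apply_gate swap_gate [u, v] f b = f (b(u := b v, v := b u))"
proof -
  have one: "{bs :: bool list. length bs = 0} = {[]}" by auto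
  have idx: "bits_index [True, True] = 3" "bits_index [True, False] = 2"
    "bits_index [False, True] = 1" "bits_index [False, False] = 0"
    by (simp_all add: bits_index_Cons bits_index_def)
  have "apply_gate swap_gate [u, v] f b = f (upd_wires b [u, v] [b v, b u])"
    unfolding apply_gate_def
    by (cases "b u"; cases "b v")
      (simp_all add: sum_lists_Suc one idx swap_gate_def mat_of_rows_list_def eval_nat_numeral)
  also have "upd_wires b [u, v] [b v, b u] = b(u := b v, v := b u)"
    using assms by (auto simp: fun_eq_iff upd_wires_def)
  finally show ?thesis .
qed

section \<open>Selecting gates by control qubits\<close>

text \<open>The wires of a block from \<open>length qs\<close> on are its ancillas. They go to
  \<open>base + j\<close> without subtracting \<open>length qs\<close>: a few wires are wasted, but
  a block on at most \<open>A\<close> wires clearly stays below \<open>base + A\<close>.\<close>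

definition place :: "nat \<Rightarrow> nat list \<Rightarrow> nat \<Rightarrow> nat" where
  "place base qs j = (if j < length qs then qs ! j else base + j)"

lemma inj_place:
  assumes "distinct qs" "set qs \<subseteq> {..<base}"
  shows "inj (place base qs)"
proof (rule injI)
  fix i j assume "place base qs i = place base qs j"
  moreover have "qs ! i \<noteq> base + j" "base + j \<noteq> qs ! i" if "i < length qs" for i j
    using assms(2) nth_mem[OF that] by auto
  ultimately show "i = j"
    using assms(1)
    by (cases "i < length qs"; cases "j < length qs") (auto simp: place_def nth_eq_iff_index_eq)
qed

lemma map_place: "map (place base qs) [0..<length qs] = qs"
  by (rule nth_equalityI) (auto simp: place_def)

lemma controlled_carrier:
  "M \<in> carrier_mat (2 ^ k) (2 ^ k) \<Longrightarrow> controlled M \<in> carrier_mat (2 ^ Suc k) (2 ^ Suc k)"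
  by (auto simp: controlled_def)

text \<open>The control has the fixed value \<open>x\<close> on the support of \<open>f\<close>, so
  the controlled gate is \<open>V\<close> or nothing on the whole state. Where
  \<open>b w \<noteq> x\<close>, both versions vanish because \<open>V\<close> does not touch
  \<open>w\<close>.\<close>

lemma run_controlled_block:
  assumes V: "V \<in> carrier_mat (2 ^ length qs) (2 ^ length qs)"
    and D: "circuit_over G (Suc (length qs) + a) D"
    and impl: "implements (Suc (length qs)) a D (controlled V)"
    and qs: "distinct (w # qs)" "set (w # qs) \<subseteq> {..<base}"
    and f: "\<And>b q. f b \<noteq> 0 \<Longrightarrow> base \<le> q \<Longrightarrow> \<not> b q"
    and w: "\<And>b. f b \<noteq> 0 \<Longrightarrow> b w = x"
  shows "run_circuit (relabel (place base (w # qs)) D) f = (if x then apply_gate V qs f else f)"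
proof -
  let ?k = "Suc (length qs)" and ?\<rho> = "place base (w # qs)"
  have "run_circuit (relabel ?\<rho> D) f = run_circuit (relabel ?\<rho> [(controlled V, [0..<?k])]) f"
  proof (rule run_circuit_eq_from_basis)
    show "inj ?\<rho>" using qs by (rule inj_place)
    show "run_circuit D (basis_state y) = run_circuit [(controlled V, [0..<?k])] (basis_state y)"
      if "length y = ?k" for y
      using impl controlled_carrier[OF V] D that by (rule implements_run_circuit)
    show "\<not> b (?\<rho> j)" if "f b \<noteq> 0" "?k \<le> j" for b j
      using f[OF that(1)] that(2) by (simp add: place_def)
  qed
  also have "\<dots> = apply_gate (controlled V) (w # qs) f"
    using map_place[of base "w # qs"] by simp
  also have "\<dots> = (\<lambda>b. if b w then apply_gate V qs f b else f b)"
    using apply_gate_controlled[OF V qs(1)] by blast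
  also have "\<dots> = (if x then apply_gate V qs f else f)"
  proof
    fix b
    have "apply_gate V qs f b = 0" if "b w \<noteq> x"
    proof (rule ccontr)
      assume "apply_gate V qs f b \<noteq> 0"
      then have "run_circuit [(V, qs)] f b \<noteq> 0" by simp
      then have "b w = x"
        using qs(1) w by (intro run_circuit_support[of "[(V, qs)]" "set qs" "\<lambda>b. b w = x" f b]) auto
      then show False using that by simp
    qed
    then show "(if b w then apply_gate V qs f b else f b) = (if x then apply_gate V qs f else f) b"
      using w[of b] by (cases "b w"; cases x) auto
  qed
  finally show ?thesis .
qed

definition select :: "bool list \<Rightarrow> circuit \<Rightarrow> circuit" where
  "select x P = map snd (filter fst (zip x P))"

lemma select_simps [simp]:
  "select [] P = []" "select x [] = []" "select (c # x) (g # P) = (if c then [g] else []) @ select x P"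
  by (simp_all add: select_def)

lemma subseq_select: "subseq S P \<Longrightarrow> \<exists>x. length x = length P \<and> select x P = S"
proof (induction rule: list_emb.induct)
  case (list_emb_Nil P)
  have "select (replicate (length P) False) P = []" by (induction P) auto
  then show ?case by (intro exI[of _ "replicate (length P) False"]) simp
next
  case (list_emb_Cons xs ys y)
  then obtain x where "length x = length ys" "select x ys = xs" by blast
  then show ?case by (intro exI[of _ "False # x"]) simp
next
  case (list_emb_Cons2 x y xs ys)
  then obtain z where "length z = length ys" "select z ys = xs" by blast
  then show ?case using list_emb_Cons2 by (intro exI[of _ "True # z"]) simp
qed

text \<open>
  The \<open>i\<close>-th gate of the list is switched on by wire \<open>w + i\<close>; all blocks share the ancillas from
  \<open>base\<close> on.
\<close>

fun controlled_circuit ::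
  "(complex mat \<Rightarrow> circuit) \<Rightarrow> nat \<Rightarrow> nat \<Rightarrow> circuit \<Rightarrow> circuit" where
  "controlled_circuit D base w [] = []"
| "controlled_circuit D base w ((V, qs) # P) =
     relabel (place base (w # qs)) (D V) @ controlled_circuit D base (Suc w) P"

text \<open>\<open>A\<close> bounds the wires of a block including its ancillas, so that one stretch
  of ancillas serves all blocks in turn; \<open>k\<close> can be recovered from the dimension of
  \<open>V\<close>.\<close>

definition controlled_impl :: "complex mat set \<Rightarrow> nat \<Rightarrow> complex mat \<Rightarrow> circuit \<Rightarrow> bool" where
  "controlled_impl G A V D \<longleftrightarrow> (\<exists>k a. V \<in> carrier_mat (2 ^ k) (2 ^ k) \<and> Suc k + a \<le> A \<and>
     circuit_over G (Suc k + a) D \<and> implements (Suc k) a D (controlled V))"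

lemma controlled_implE:
  assumes "controlled_impl G A V D" "dim_row V = 2 ^ k"
  obtains a where "V \<in> carrier_mat (2 ^ k) (2 ^ k)" "Suc k + a \<le> A"
    "circuit_over G (Suc k + a) D" "implements (Suc k) a D (controlled V)"
proof -
  obtain k' a where *: "V \<in> carrier_mat (2 ^ k') (2 ^ k')" "Suc k' + a \<le> A"
    "circuit_over G (Suc k' + a) D" "implements (Suc k') a D (controlled V)"
    using assms(1) unfolding controlled_impl_def by blast
  have "(2::nat) ^ k' = 2 ^ k" using *(1) assms(2) by simp
  then have "k' = k" by simp
  then show ?thesis using * that by blast
qed

lemma length_controlled_circuit:
  "length (controlled_circuit D base w P) = (\<Sum>(V, qs)\<leftarrow>P. length (D V))"
  by (induction D base w P rule: controlled_circuit.induct) (auto simp: relabel_def)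

lemma controlled_circuit_over:
  assumes D: "\<And>V. V \<in> Vs \<Longrightarrow> controlled_impl G A V (D V)"
    and P: "\<And>V qs. (V, qs) \<in> set P \<Longrightarrow>
      V \<in> Vs \<and> dim_row V = 2 ^ length qs \<and> distinct qs \<and> set qs \<subseteq> {..<base} - {w..<w + length P}"
    and w: "w + length P \<le> base"
  shows "circuit_over G (base + A) (controlled_circuit D base w P)"
  using P w
proof (induction P arbitrary: w)
  case Nil
  then show ?case by (simp add: circuit_over_def)
next
  case (Cons g P)
  obtain V qs where g: "g = (V, qs)" by force
  have V: "V \<in> Vs" "dim_row V = 2 ^ length qs" "distinct qs"
    "set qs \<subseteq> {..<base} - {w..<w + length (g # P)}"
    using Cons.prems(1)[of V qs] by (auto simp: g)
  obtain a where a: "Suc (length qs) + a \<le> A" "circuit_over G (Suc (length qs) + a) (D V)"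
    using controlled_implE[OF D[OF V(1)] V(2)] by metis
  have inj: "inj (place base (w # qs))"
    using V Cons.prems(2) by (intro inj_place) auto
  have place: "place base (w # qs) j < base + A" if "j < Suc (length qs) + a" for j
  proof (cases "j < Suc (length qs)")
    case True
    then have "(w # qs) ! j \<in> set (w # qs)" by (intro nth_mem) simp
    then have "(w # qs) ! j < base" using V(4) Cons.prems(2) by auto
    then show ?thesis using True by (simp add: place_def)
  qed (use that a in \<open>simp add: place_def\<close>)
  have "circuit_over G (base + A) (relabel (place base (w # qs)) (D V))"
    unfolding circuit_over_def relabel_def
  proof (clarsimp, intro conjI)
    fix M rs assume "(M, rs) \<in> set (D V)"
    then have *: "M \<in> G" "dim_row M = 2 ^ length rs" "distinct rs"
      "set rs \<subseteq> {..<Suc (length qs) + a}"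
      using a(2) unfolding circuit_over_def by fast+
    show "M \<in> G" "dim_row M = 2 ^ length rs" using * by auto
    show "distinct (map (place base (w # qs)) rs)"
      using * inj by (simp add: distinct_map inj_on_subset)
    show "place base (w # qs) ` set rs \<subseteq> {..<base + A}"
      using *(4) place by auto
  qed
  moreover have "circuit_over G (base + A) (controlled_circuit D base (Suc w) P)"
  proof (rule Cons.IH)
    fix V' qs' assume "(V', qs') \<in> set P"
    then show "V' \<in> Vs \<and> dim_row V' = 2 ^ length qs' \<and> distinct qs' \<and>
      set qs' \<subseteq> {..<base} - {Suc w..<Suc w + length P}"
      using Cons.prems(1)[of V' qs'] by auto
  qed (use Cons.prems in simp)
  ultimately show ?case by (auto simp: g circuit_over_def)
qed

text \<open>The gates avoid control wires and ancillas, so by \<open>run_circuit_support\<close>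
  both keep their values whether or not a gate is switched on, and the next block meets the same
  situation with its control one wire further.\<close>

lemma run_controlled_circuit:
  assumes D: "\<And>V. V \<in> Vs \<Longrightarrow> controlled_impl G A V (D V)"
    and P: "\<And>V qs. (V, qs) \<in> set P \<Longrightarrow>
      V \<in> Vs \<and> dim_row V = 2 ^ length qs \<and> distinct qs \<and> set qs \<subseteq> {..<base} - {w..<w + length P}"
    and w: "w + length P \<le> base"
    and x: "length x = length P"
    and f: "\<And>b q. f b \<noteq> 0 \<Longrightarrow> base \<le> q \<Longrightarrow> \<not> b q"
      "\<And>b j. f b \<noteq> 0 \<Longrightarrow> j < length P \<Longrightarrow> b (w + j) = x ! j"
  shows "run_circuit (controlled_circuit D base w P) f = run_circuit (select x P) f"
  using P w x f
proof (induction P arbitrary: w x f)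
  case Nil
  then show ?case by simp
next
  case (Cons g P)
  obtain V qs where g: "g = (V, qs)" by force
  obtain c x' where x: "x = c # x'" using Cons.prems(3) by (cases x) auto
  have V: "V \<in> Vs" "dim_row V = 2 ^ length qs" "distinct qs"
    "set qs \<subseteq> {..<base} - {w..<w + length (g # P)}"
    using Cons.prems(1)[of V qs] by (auto simp: g)
  define f' where "f' = (if c then apply_gate V qs f else f)"
  obtain a where a: "V \<in> carrier_mat (2 ^ length qs) (2 ^ length qs)"
    "circuit_over G (Suc (length qs) + a) (D V)"
    "implements (Suc (length qs)) a (D V) (controlled V)"
    using controlled_implE[OF D[OF V(1)] V(2)] by metis
  have block: "run_circuit (relabel (place base (w # qs)) (D V)) f = f'"
    unfolding f'_def
  proof (rule run_controlled_block[OF a])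
    show "distinct (w # qs)" "set (w # qs) \<subseteq> {..<base}" using V Cons.prems(2) by auto
    show "b w = c" if "f b \<noteq> 0" for b using Cons.prems(5)[OF that, of 0] by (simp add: x)
  qed (use Cons.prems(4) in blast)
  have f': "f' b \<noteq> 0 \<Longrightarrow> (\<forall>q\<ge>base. \<not> b q) \<and> (\<forall>j<length (g # P). b (w + j) = x ! j)" for b
  proof -
    assume nz: "f' b \<noteq> 0"
    let ?Q = "\<lambda>b. (\<forall>q\<ge>base. \<not> b q) \<and> (\<forall>j<length (g # P). b (w + j) = x ! j)"
    have Qf: "?Q b" if "f b \<noteq> 0" for b using Cons.prems(4,5)[OF that] by blast
    show "?Q b"
    proof (cases c)
      case True
      show ?thesis
      proof (rule run_circuit_support[of "[(V, qs)]" "set qs" ?Q f b])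
        show "run_circuit [(V, qs)] f b \<noteq> 0" using nz True by (simp add: f'_def)
        fix b b' :: "nat \<Rightarrow> bool"
        assume eq: "\<And>q. q \<notin> set qs \<Longrightarrow> b q = b' q" and Q: "?Q b"
        have "b' q = b q" if "q \<ge> base \<or> q \<in> {w..<w + length (g # P)}" for q
        proof -
          have "q \<notin> set qs" using that V(4) by auto
          then show ?thesis using eq by simp
        qed
        then show "?Q b'" using Q by simp
      qed (use Qf in auto)
    qed (use nz Qf in \<open>auto simp: f'_def\<close>)
  qed
  have "run_circuit (controlled_circuit D base (Suc w) P) f' = run_circuit (select x' P) f'"
  proof (rule Cons.IH)
    fix V' qs' assume "(V', qs') \<in> set P"
    then show "V' \<in> Vs \<and> dim_row V' = 2 ^ length qs' \<and> distinct qs' \<and>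
      set qs' \<subseteq> {..<base} - {Suc w..<Suc w + length P}"
      using Cons.prems(1)[of V' qs'] by auto
  next
    fix b j assume "f' b \<noteq> 0" "j < length P"
    then show "b (Suc w + j) = x' ! j" using f'[of b] by (auto simp: x dest: spec[of _ "Suc j"])
  next
    fix b q assume "f' b \<noteq> 0" "base \<le> q"
    then show "\<not> b q" using f'[of b] by blast
  qed (use Cons.prems(2,3) x in auto)
  then show ?case using block by (auto simp: g x f'_def)
qed

text \<open>Leaves a question about subsequences of one gate list only. A subsequence has to agree
  with \<open>C\<close> just on inputs whose wires from \<open>n\<close> on are zero, and must then
  restore those wires.\<close>

lemma controlled_selection:
  assumes D: "\<And>V. V \<in> Vs \<Longrightarrow> controlled_impl G A V (D V)"
    and P: "circuit_over Vs N P" and "n \<le> N"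
  shows "\<exists>U. circuit_over G (n + length P + (N - n + A)) U \<and>
     circuit_size U = (\<Sum>(V, qs)\<leftarrow>P. length (D V)) \<and>
     universal_for n (length P) (N - n + A) U {C. circuit_over G' n C \<and>
       (\<exists>S. subseq S P \<and> (\<forall>y. length y = n \<longrightarrow>
          run_circuit S (basis_state y) = run_circuit C (basis_state y)))}"
proof -
  define m where "m = length P"
  \<comment> \<open>\<open>universal_for\<close> orders the register as data, encoding, ancillas, so
    the scratch wires of \<open>P\<close> jump over the \<open>m\<close> encoding wires.\<close>
  define \<eta> where "\<eta> q = (if q < n then q else q + m)" for q
  define base where "base = N + m"
  define U where "U = controlled_circuit D base n (relabel \<eta> P)"
  have \<eta>: "inj \<eta>" by (rule injI) (auto simp: \<eta>_def split: if_splits)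
  have range: "q \<notin> range \<eta> \<longleftrightarrow> q \<in> {n..<n + m}" for q
  proof
    show "q \<in> {n..<n + m}" if "q \<notin> range \<eta>"
    proof (rule ccontr)
      assume "q \<notin> {n..<n + m}"
      then have "q = \<eta> (if q < n then q else q - m)" by (auto simp: \<eta>_def)
      then show False using that by blast
    qed
  qed (auto simp: \<eta>_def)
  have wf: "V \<in> Vs \<and> dim_row V = 2 ^ length qs \<and> distinct qs \<and>
      set qs \<subseteq> {..<base} - {n..<n + length (relabel \<eta> P)}" if mem: "(V, qs) \<in> set (relabel \<eta> P)" for V qs
  proof -
    from mem obtain rs where rs: "(V, rs) \<in> set P" "qs = map \<eta> rs" by (auto simp: relabel_def)
    then have *: "V \<in> Vs" "dim_row V = 2 ^ length rs" "distinct rs" "set rs \<subseteq> {..<N}"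
      using P unfolding circuit_over_def by fast+
    have "\<eta> q \<in> {..<base} - {n..<n + m}" if "q < N" for q
      using that by (auto simp: \<eta>_def base_def)
    then have "set qs \<subseteq> {..<base} - {n..<n + m}"
      unfolding rs(2) set_map using *(4) by (intro image_subsetI) blast
    then show ?thesis using * rs(2) inj_on_subset[OF \<eta>] by (simp add: distinct_map relabel_def m_def)
  qed
  have len: "n + length (relabel \<eta> P) \<le> base" using \<open>n \<le> N\<close> by (simp add: relabel_def base_def m_def)
  have tot: "n + m + (N - n + A) = base + A" using \<open>n \<le> N\<close> by (simp add: base_def)
  have over: "circuit_over G (base + A) U"
    unfolding U_def by (rule controlled_circuit_over[OF D wf len])
  have "circuit_size U = (\<Sum>(V, qs)\<leftarrow>P. length (D V))"
    unfolding circuit_size_def U_def length_controlled_circuit relabel_def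
    by (simp add: comp_def case_prod_unfold)
  moreover have "universal_for n m (N - n + A) U {C. circuit_over G' n C \<and>
       (\<exists>S. subseq S P \<and> (\<forall>y. length y = n \<longrightarrow>
          run_circuit S (basis_state y) = run_circuit C (basis_state y)))}"
    unfolding universal_for_def
  proof clarify
    fix C S assume C: "circuit_over G' n C" and sub: "subseq S P"
      and eq: "\<forall>y. length y = n \<longrightarrow> run_circuit S (basis_state y) = run_circuit C (basis_state y)"
    obtain x where x: "length x = length P" "select x P = S" using subseq_select[OF sub] by blast
    have "circuit_mat (n + m + (N - n + A)) U *\<^sub>v
          (ket y \<otimes>\<^sub>v ket x \<otimes>\<^sub>v ket (replicate (N - n + A) False)) =
        (circuit_mat n C *\<^sub>v ket y) \<otimes>\<^sub>v ket x \<otimes>\<^sub>v ket (replicate (N - n + A) False)"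
      if y: "length y = n" for y
    proof -
      define z where "z = x @ replicate (N - n + A) False"
      define \<chi> :: "(nat \<Rightarrow> bool) \<Rightarrow> complex" where "\<chi> b = of_bool (\<forall>j<m. b (n + j) = x ! j)" for b
      have lz: "n + length z = base + A" using tot x by (simp add: z_def m_def)
      have bs: "basis_state (y @ x) = (\<lambda>b. basis_state y (b \<circ> \<eta>) * \<chi> b)"
      proof
        fix b
        have "b = bits_fun (y @ x) \<longleftrightarrow> b \<circ> \<eta> = bits_fun y \<and> (\<forall>j<m. b (n + j) = x ! j)"
        proof safe
          assume *: "b \<circ> \<eta> = bits_fun y" "\<forall>j<m. b (n + j) = x ! j"
          show "b = bits_fun (y @ x)"
          proof
            fix q
            show "b q = bits_fun (y @ x) q"
            proof (cases "q \<in> range \<eta>")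
              case True
              then obtain r where r: "q = \<eta> r" by blast
              then have "b q = bits_fun y r" using fun_cong[OF *(1), of r] by simp
              then show ?thesis using r y x
                by (auto simp: bits_fun_def \<eta>_def nth_append m_def split: if_splits)
            next
              case False
              then obtain j where "q = n + j" "j < m" unfolding range
                by (metis add_less_cancel_left atLeastLessThan_iff le_Suc_ex)
              then show ?thesis using *(2) x y by (simp add: bits_fun_def m_def nth_append)
            qed
          qed
        qed (use x y in \<open>auto simp: fun_eq_iff bits_fun_def \<eta>_def nth_append m_def\<close>)
        then show "basis_state (y @ x) b = basis_state y (b \<circ> \<eta>) * \<chi> b"
          unfolding basis_state_def \<chi>_def by simp
      qed
      have sel: "select x (relabel \<eta> P) = relabel \<eta> S"
        unfolding x(2)[symmetric] using x(1)
        by (induction x P rule: list_induct2) (auto simp: relabel_def)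
      have "run_circuit U (basis_state (y @ x)) = run_circuit (relabel \<eta> S) (basis_state (y @ x))"
        unfolding U_def sel[symmetric]
      proof (rule run_controlled_circuit[OF D wf len])
        show "length x = length (relabel \<eta> P)" using x by (simp add: relabel_def)
        fix b assume "basis_state (y @ x) b \<noteq> 0"
        then have b: "b = bits_fun (y @ x)" by (simp add: basis_state_def split: if_splits)
        show "\<not> b q" if "base \<le> q" for q
          using that y x \<open>n \<le> N\<close> by (auto simp: b bits_fun_def base_def m_def)
        show "b (n + j) = x ! j" if "j < length (relabel \<eta> P)" for j
          using that y x by (simp add: b bits_fun_def relabel_def nth_append)
      qed
      also have "\<dots> = (\<lambda>b. run_circuit S (basis_state y) (b \<circ> \<eta>) * \<chi> b)"
        unfolding bs by (rule run_circuit_relabel[OF \<eta>]) (use range in \<open>auto simp: \<chi>_def\<close>)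
      also have "\<dots> = (\<lambda>b. run_circuit C (basis_state y) (b \<circ> \<eta>) * \<chi> b)"
        using eq y by simp
      finally have run: "run_circuit U (basis_state (y @ x)) = \<dots>" .
      have "ket y \<otimes>\<^sub>v ket x \<otimes>\<^sub>v ket (replicate (N - n + A) False) = ket (y @ z)"
        by (simp add: ket_append z_def)
      moreover have "basis_state (y @ z) = basis_state (y @ x)"
        using basis_state_append_zeros[of "y @ x" "N - n + A"] by (simp add: z_def)
      moreover have "length (y @ z) = base + A" using lz y by simp
      ultimately have "ket y \<otimes>\<^sub>v ket x \<otimes>\<^sub>v ket (replicate (N - n + A) False) =
          amp_vec (base + A) (basis_state (y @ x))"
        using ket_eq_amp_vec[of "y @ z"] by simp
      then have "circuit_mat (n + m + (N - n + A)) U *\<^sub>v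
          (ket y \<otimes>\<^sub>v ket x \<otimes>\<^sub>v ket (replicate (N - n + A) False)) =
          amp_vec (base + A) (\<lambda>b. run_circuit C (basis_state y) (b \<circ> \<eta>) * \<chi> b)"
        unfolding tot using circuit_over_amp_vec[OF over] run by simp
      also have "\<dots> = amp_vec (base + A) (\<lambda>b. if \<forall>q<length z. b (n + q) = z ! q
          then run_circuit C (basis_state y) (\<lambda>q. q < n \<and> b q) else 0)"
        unfolding amp_vec_def
      proof (intro arg_cong2[of _ _ _ _ vec] refl ext)
        fix i
        let ?b = "vals (base + A) i"
        have big: "\<not> ?b q" if "q \<ge> base + A" for q using that by (simp add: vals_def)
        \<comment> \<open>If the wires from \<open>n\<close> on do not spell \<open>z\<close>, then
          either the encoding is wrong and \<open>\<chi>\<close> vanishes, or an ancilla is set and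
          the run of \<open>C\<close>, confined to \<open>n\<close> wires, vanishes.\<close>
        show "run_circuit C (basis_state y) (?b \<circ> \<eta>) * \<chi> ?b = (if \<forall>q<length z. ?b (n + q) = z ! q
          then run_circuit C (basis_state y) (\<lambda>q. q < n \<and> ?b q) else 0)"
        proof (cases "\<forall>q<length z. ?b (n + q) = z ! q")
          case True
          have zx: "\<forall>j<m. ?b (n + j) = x ! j"
          proof (intro allI impI)
            fix j assume "j < m"
            then show "?b (n + j) = x ! j"
              using True[rule_format, of j] x by (simp add: z_def m_def nth_append)
          qed
          have zero: "\<not> ?b q" if q: "q \<ge> n + m" for q
          proof (cases "q < base + A")
            case q': True
            have "?b (n + (q - n)) = z ! (q - n)" using lz q q' by (intro True[rule_format]) simp
            moreover have "\<not> z ! (q - n)"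
              using q q' tot x by (auto simp: z_def nth_append m_def)
            ultimately show ?thesis using q by simp
          qed (use big in simp)
          have "?b \<circ> \<eta> = (\<lambda>q. q < n \<and> ?b q)"
          proof
            fix q show "(?b \<circ> \<eta>) q = (q < n \<and> ?b q)"
              using zero[of "q + m"] by (simp add: \<eta>_def)
          qed
          then show ?thesis using True zx by (simp only: \<chi>_def) simp
        next
          case False
          then obtain q where q: "q < length z" "?b (n + q) \<noteq> z ! q" by blast
          show ?thesis
          proof (cases "q < m")
            case True
            then have "\<chi> ?b = 0" using q x by (auto simp: \<chi>_def z_def nth_append m_def)
            then show ?thesis by (simp only: if_not_P[OF False] mult_zero_right)
          next
            case qm: False
            then have "?b (n + q)" using q x by (auto simp: z_def nth_append m_def)
            moreover have "\<eta> (n + q - m) = n + q" using qm by (auto simp: \<eta>_def)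
            ultimately have bq: "(?b \<circ> \<eta>) (n + q - m)" by simp
            have "run_circuit C (basis_state y) (?b \<circ> \<eta>) = 0"
            proof (rule ccontr)
              assume "run_circuit C (basis_state y) (?b \<circ> \<eta>) \<noteq> 0"
              from run_circuit_basis_zero[OF this circuit_over_wires[OF C], of "n + q - m"]
              show False using bq qm y by simp
            qed
            then show ?thesis by (simp only: if_not_P[OF False] mult_zero_left)
          qed
        qed
      qed
      also have "\<dots> = amp_vec n (run_circuit C (basis_state y)) \<otimes>\<^sub>v ket z"
        unfolding tensor_amp_vec_ket lz ..
      also have "amp_vec n (run_circuit C (basis_state y)) = circuit_mat n C *\<^sub>v ket y"
        using circuit_over_amp_vec[OF C] y by (simp add: ket_eq_amp_vec)
      finally show ?thesis by (simp add: z_def ket_append)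
    qed
    then show "\<exists>x. length x = m \<and> (\<forall>y. length y = n \<longrightarrow>
        circuit_mat (n + m + (N - n + A)) U *\<^sub>v
          (ket y \<otimes>\<^sub>v ket x \<otimes>\<^sub>v ket (replicate (N - n + A) False)) =
        (circuit_mat n C *\<^sub>v ket y) \<otimes>\<^sub>v ket x \<otimes>\<^sub>v ket (replicate (N - n + A) False))"
      using x by (auto simp: m_def)
  qed
  ultimately show ?thesis
    using over unfolding tot[symmetric] m_def by (intro exI[of _ U] conjI)
qed

section \<open>A memory with a single port\<close>

text \<open>The edges from \<open>x\<close> to \<open>f x\<close> and to \<open>g x\<close> form
  cycles that alternate between the two involutions, hence even cycles. The induction removes
  \<open>x\<close> and \<open>f x\<close> and splices the cycle by letting \<open>g\<close> join the
  two neighbours left over.\<close>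

lemma two_colouring:
  assumes "finite X"
    and "\<And>x. x \<in> X \<Longrightarrow> f x \<in> X \<and> f x \<noteq> x \<and> f (f x) = x"
    and "\<And>x. x \<in> X \<Longrightarrow> g x \<in> X \<and> g x \<noteq> x \<and> g (g x) = x"
  shows "\<exists>col :: 'a \<Rightarrow> bool. \<forall>x\<in>X. col (f x) \<noteq> col x \<and> col (g x) \<noteq> col x"
  using assms
proof (induction "card X" arbitrary: X g rule: less_induct)
  case less
  note f = less.prems(2) and g = less.prems(3)
  show ?case
  proof (cases "X = {}")
    case False
    then obtain x where x: "x \<in> X" by blast
    define y X' where "y = f x" and "X' = X - {x, y}"
    have y: "y \<in> X" "y \<noteq> x" "f y = x" using f[OF x] by (auto simp: y_def)
    have card: "card X' < card X"
      unfolding X'_def using less.prems(1) x by (intro psubset_card_mono) auto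
    have fin: "finite X'" using less.prems(1) by (simp add: X'_def)
    have f': "f z \<in> X' \<and> f z \<noteq> z \<and> f (f z) = z" if "z \<in> X'" for z
    proof -
      have z: "z \<in> X" "z \<noteq> x" "z \<noteq> y" using that by (auto simp: X'_def)
      have "f z \<noteq> x" using f[OF z(1)] z(3) by (auto simp: y_def)
      moreover have "f z \<noteq> y" using f[OF z(1)] z(2) y(3) by auto
      ultimately show ?thesis using f[OF z(1)] by (simp add: X'_def)
    qed
    show ?thesis
    proof (cases "g x = y")
      case True
      then have gy: "g y = x" using g[OF x] by auto
      have g': "g z \<in> X' \<and> g z \<noteq> z \<and> g (g z) = z" if "z \<in> X'" for z
      proof -
        have z: "z \<in> X" "z \<noteq> x" "z \<noteq> y" using that by (auto simp: X'_def)
        have "g z \<noteq> x" using g[OF z(1)] z(3) True by auto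
        moreover have "g z \<noteq> y" using g[OF z(1)] z(2) gy by auto
        ultimately show ?thesis using g[OF z(1)] by (simp add: X'_def)
      qed
      from less.hyps[OF card fin f' g'] obtain col :: "'a \<Rightarrow> bool" where
        col: "\<forall>z\<in>X'. col (f z) \<noteq> col z \<and> col (g z) \<noteq> col z" by blast
      define col' where "col' = col(x := True, y := False)"
      have "col' (f z) \<noteq> col' z \<and> col' (g z) \<noteq> col' z" if "z \<in> X" for z
      proof (cases "z \<in> X'")
        case z: True
        then have "f z \<in> X'" "g z \<in> X'"
          using f' g' by auto
        then show ?thesis using z bspec[OF col z] by (auto simp: col'_def X'_def)
      next
        case False
        then have "z = x \<or> z = y" using that by (auto simp: X'_def)
        then show ?thesis using y True gy by (auto simp: col'_def y_def[symmetric])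
      qed
      then show ?thesis by blast
    next
      case False
      define x' y' where "x' = g x" and "y' = g y"
      define g' where "g' = g(x' := y', y' := x')"
      have gg: "g x' = x" "g y' = y" using g[OF x] g[OF y(1)] by (auto simp: x'_def y'_def)
      have "x' \<noteq> y" "x' \<noteq> x" "y' \<noteq> y" "x' \<in> X" "y' \<in> X"
        using False g[OF x] g[OF y(1)] by (auto simp: x'_def y'_def)
      moreover have "y' \<noteq> x" using gg False by (auto simp: x'_def)
      moreover have "x' \<noteq> y'" using gg y(2) by auto
      ultimately have xy': "x' \<in> X'" "y' \<in> X'" "x' \<noteq> y'" "g x' = x" "g y' = y"
        using gg by (auto simp: X'_def)
      have g': "g' z \<in> X' \<and> g' z \<noteq> z \<and> g' (g' z) = z" if "z \<in> X'" for z
      proof (cases "z = x' \<or> z = y'")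
        case True
        then show ?thesis using xy' by (auto simp: g'_def)
      next
        case z: False
        have zX: "z \<in> X" "z \<noteq> x" "z \<noteq> y" using that by (auto simp: X'_def)
        have gz: "g (g z) = z" "g z \<in> X" "g z \<noteq> z" using g[OF zX(1)] by auto
        have "g z \<noteq> x" using gz(1) z by (auto simp: x'_def)
        moreover have "g z \<noteq> y" using gz(1) z by (auto simp: y'_def)
        moreover have "g z \<noteq> x'" using gz(1) xy'(4) zX by auto
        moreover have "g z \<noteq> y'" using gz(1) xy'(5) zX by auto
        ultimately show ?thesis using z gz by (auto simp: g'_def X'_def)
      qed
      from less.hyps[OF card fin f' g'] obtain col :: "'a \<Rightarrow> bool" where
        col: "\<forall>z\<in>X'. col (f z) \<noteq> col z \<and> col (g' z) \<noteq> col z" by blast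
      \<comment> \<open>The new edge of \<open>g'\<close> makes the colours of \<open>x'\<close> and
        \<open>y'\<close> differ, so \<open>x\<close> and \<open>y\<close> fit back between them in
        alternating colours.\<close>
      define col' where "col' = col(x := \<not> col x', y := col x')"
      have cy': "col y' = (\<not> col x')" using bspec[OF col xy'(1)] xy'(3) by (simp add: g'_def)
      have "col' (f z) \<noteq> col' z \<and> col' (g z) \<noteq> col' z" if "z \<in> X" for z
      proof (cases "z \<in> X'")
        case z: True
        then have z': "z \<noteq> x" "z \<noteq> y" "f z \<noteq> x" "f z \<noteq> y" using f'[OF z] by (auto simp: X'_def)
        consider "z = x'" | "z = y'" | "z \<noteq> x'" "z \<noteq> y'" by blast
        then have "col' (g z) \<noteq> col' z"
        proof cases
          case 3
          then have "g' z = g z" by (simp add: g'_def)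
          moreover have "g' z \<in> X'" using g' z by blast
          ultimately have "g z \<noteq> x" "g z \<noteq> y" "col (g z) \<noteq> col z"
            using bspec[OF col z] by (auto simp: X'_def)
          then show ?thesis using z' by (simp add: col'_def)
        qed (use xy' cy' z' y in \<open>auto simp: col'_def\<close>)
        then show ?thesis using z' bspec[OF col z] by (simp add: col'_def)
      next
        case False
        then have "z = x \<or> z = y" using that by (auto simp: X'_def)
        then show ?thesis using y xy' cy'
          by (auto simp: col'_def y_def[symmetric] x'_def[symmetric] y'_def[symmetric] X'_def)
      qed
      then show ?thesis by blast
    qed
  qed simp
qed

section \<open>Memory steps and the path of a content through them\<close>

lemma subseq_set_subset: "subseq xs ys \<Longrightarrow> set xs \<subseteq> set ys"
  by (auto elim: list_emb_set)

fun move :: "(nat \<times> nat) list \<Rightarrow> nat \<Rightarrow> nat" where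
  "move [] l = l"
| "move ((u, v) # xs) l = move xs (if l = u then v else if l = v then u else l)"

lemma move_append [simp]: "move (xs @ ys) l = move ys (move xs l)"
  by (induction xs arbitrary: l) auto

lemma move_outside:
  assumes "set xs \<subseteq> R \<times> R" "l \<notin> R"
  shows "move xs l = l"
  using assms by (induction xs) auto

lemma move_inside:
  assumes "set xs \<subseteq> R \<times> R" "l \<in> R"
  shows "move xs l \<in> R"
  using assms by (induction xs arbitrary: l) auto

text \<open>
  A memory of \<open>2 ^ d\<close> cells starting at the port \<open>p\<close>: \<open>mem_step d p t\<close> are the optional swaps between
  accesses \<open>t\<close> and \<open>t + 1\<close> to the port. Two memories of half the size are accessed once for every
  pair of accesses \<open>2 * i\<close>, \<open>2 * i + 1\<close>; this is Valiant's recursion for edge-universal graphs.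
\<close>

fun mem_step :: "nat \<Rightarrow> nat \<Rightarrow> nat \<Rightarrow> (nat \<times> nat) list" where
  "mem_step 0 p t = []"
| "mem_step (Suc d) p t =
    (if even t then [(p, p + 2 ^ d)]
     else [(p, p + 2 ^ d)] @ mem_step d p (t div 2) @ mem_step d (p + 2 ^ d) (t div 2) @
          [(p, p + 2 ^ d)])"

lemma mem_step_wires: "set (mem_step d p t) \<subseteq> {p..<p + 2 ^ d} \<times> {p..<p + 2 ^ d}"
proof (induction d arbitrary: p t)
  case (Suc d)
  have "set (mem_step d p (t div 2)) \<subseteq> {p..<p + 2 ^ Suc d} \<times> {p..<p + 2 ^ Suc d}"
    by (rule order_trans[OF Suc]) auto
  moreover have "set (mem_step d (p + 2 ^ d) (t div 2)) \<subseteq> {p..<p + 2 ^ Suc d} \<times> {p..<p + 2 ^ Suc d}"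
    by (rule order_trans[OF Suc]) auto
  ultimately show ?case by auto
qed simp

lemma mem_step_distinct: "(u, v) \<in> set (mem_step d p t) \<Longrightarrow> u \<noteq> v"
  by (induction d arbitrary: p t) (auto split: if_splits)

lemma sum_double: "(\<Sum>t<2 * n. f t) = (\<Sum>i<n. f (2 * i) + f (2 * i + 1))" for f :: "nat \<Rightarrow> nat"
  by (induction n) auto

text \<open>Three swaps per pair of accesses plus two memories of half the size: the total obeys
  \<open>T (d + 1) = 3 * 2 ^ d + 2 * T d\<close>, so \<open>T d = 3 / 2 * d * 2 ^ d\<close>; the
  factor 2 avoids the fraction.\<close>

lemma mem_step_size: "(\<Sum>t<2 ^ d. length (mem_step d p t)) \<le> 2 * d * 2 ^ d"
proof (induction d arbitrary: p)
  case (Suc d)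
  have "(\<Sum>t<2 ^ Suc d. length (mem_step (Suc d) p t)) =
     (\<Sum>i<2 ^ d. Suc (Suc (Suc 0)) + length (mem_step d p i) + length (mem_step d (p + 2 ^ d) i))"
    by (simp add: sum_double)
  also have "\<dots> = 3 * 2 ^ d + (\<Sum>i<2 ^ d. length (mem_step d p i)) +
      (\<Sum>i<2 ^ d. length (mem_step d (p + 2 ^ d) i))"
    by (simp only: sum.distrib) simp
  also have "\<dots> \<le> 3 * 2 ^ d + 2 * d * 2 ^ d + 2 * d * 2 ^ d"
    using Suc by (intro add_mono) auto
  finally show ?case by (simp add: algebra_simps)
qed simp

text \<open>Position at access \<open>t\<close> of what was left at the port at access
  \<open>s\<close>. An access precedes the swaps of its own step, so \<open>S s\<close> counts and
  \<open>S t\<close> does not.\<close>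

definition track :: "(nat \<Rightarrow> (nat \<times> nat) list) \<Rightarrow> nat \<Rightarrow> nat \<Rightarrow> nat \<Rightarrow> nat" where
  "track S p s t = move (concat (map S [s..<t])) p"

lemma track_refl [simp]: "track S p s s = p"
  by (simp add: track_def)

lemma track_Suc: "s \<le> t \<Longrightarrow> track S p s (Suc t) = move (S t) (track S p s t)"
  by (simp add: track_def)

lemma track_inside:
  assumes "\<And>t. set (S t) \<subseteq> R \<times> R" "p \<in> R"
  shows "track S p s t \<in> R"
  unfolding track_def using assms by (intro move_inside) auto

definition partner :: "nat \<Rightarrow> nat" where
  "partner s = (if even s then s + 1 else s - 1)"

lemma partner_facts: "partner s \<noteq> s" "partner (partner s) = s" "partner s div 2 = s div 2"
  "s < 2 * n \<Longrightarrow> partner s < 2 * n" "s div 2 = t div 2 \<Longrightarrow> s = t \<or> t = partner s"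
  unfolding partner_def by presburger+

text \<open>Each \<open>s\<close> is an edge from the pair of \<open>s\<close> to the pair of
  \<open>\<pi> s\<close> in a bipartite multigraph of degree two. Its neighbouring edges come from
  two fixed-point-free involutions: \<open>partner\<close>, and \<open>partner\<close> conjugated by
  \<open>\<pi>\<close>.\<close>

lemma benes_colouring:
  assumes "bij_betw \<pi> {..<2 * n} {..<2 * n}"
  shows "\<exists>col :: nat \<Rightarrow> bool.
    (\<forall>s<2 * n. \<forall>s'<2 * n. s \<noteq> s' \<longrightarrow> s div 2 = s' div 2 \<or> \<pi> s div 2 = \<pi> s' div 2 \<longrightarrow> col s \<noteq> col s')"
proof -
  let ?X = "{..<2 * n}"
  define \<rho> where "\<rho> = inv_into ?X \<pi>"
  have im: "\<pi> ` ?X = ?X" and inj: "inj_on \<pi> ?X" using assms by (auto simp: bij_betw_def)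
  have \<rho>: "\<rho> t \<in> ?X" "\<pi> (\<rho> t) = t" if "t \<in> ?X" for t
    using inv_into_into[of t \<pi> ?X] f_inv_into_f[of t \<pi> ?X] that unfolding im \<rho>_def by blast+
  have \<pi>: "\<pi> s \<in> ?X" "\<rho> (\<pi> s) = s" if "s \<in> ?X" for s
    using that im inv_into_f_f[OF inj that] unfolding \<rho>_def by blast+
  let ?g = "\<lambda>s. \<rho> (partner (\<pi> s))"
  have part: "partner s \<in> ?X" if "s \<in> ?X" for s
    using that partner_facts(4) by auto
  have "\<exists>col :: nat \<Rightarrow> bool. \<forall>s\<in>?X. col (partner s) \<noteq> col s \<and> col (?g s) \<noteq> col s"
  proof (rule two_colouring)
    fix s assume s: "s \<in> ?X"
    show "partner s \<in> ?X \<and> partner s \<noteq> s \<and> partner (partner s) = s"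
      using s part partner_facts by auto
    have p: "partner (\<pi> s) \<in> ?X" using s \<pi> part by blast
    then have "?g s \<noteq> s" using \<rho>(2) partner_facts(1) by metis
    then show "?g s \<in> ?X \<and> ?g s \<noteq> s \<and> ?g (?g s) = s"
      using p s \<rho> \<pi> by (simp add: partner_facts)
  qed simp
  then obtain col :: "nat \<Rightarrow> bool" where col: "\<forall>s\<in>?X. col (partner s) \<noteq> col s \<and> col (?g s) \<noteq> col s" ..
  have "col s \<noteq> col s'" if s: "s \<in> ?X" "s' \<in> ?X" "s \<noteq> s'"
    and or: "s div 2 = s' div 2 \<or> \<pi> s div 2 = \<pi> s' div 2" for s s'
    using or
  proof
    assume "s div 2 = s' div 2"
    then show ?thesis using partner_facts(5) s col by metis
  next
    assume *: "\<pi> s div 2 = \<pi> s' div 2"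
    have "\<pi> s \<noteq> \<pi> s'" using s \<pi> by metis
    then have "\<pi> s' = partner (\<pi> s)" using * partner_facts(5) by metis
    then have "s' = ?g s" using s \<pi> by metis
    then show ?thesis using col s by metis
  qed
  then show ?thesis by blast
qed


text \<open>
  The content of the port at access \<open>s\<close> is delivered back to the port at access \<open>\<pi> s\<close>, and it keeps
  clear of the port in between. Pairs with \<open>\<pi> s \<le> s\<close> only serve to make \<open>\<pi>\<close> a permutation, which
  turns the distribution over the two halves into a two-colouring problem.
\<close>

lemma routing:
  assumes "bij_betw \<pi> {..<2 ^ d} {..<2 ^ d}"
  shows "\<exists>S. (\<forall>t. subseq (S t) (mem_step d p t)) \<and>
    (\<forall>s<2 ^ d. s < \<pi> s \<longrightarrow> track S p s (\<pi> s) = p \<and>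
       (\<forall>r. s < r \<and> r < \<pi> s \<longrightarrow> track S p s r \<noteq> p))"
  using assms
proof (induction d arbitrary: \<pi> p)
  case 0
  then have "\<pi> 0 = 0" by (auto simp: bij_betw_def)
  then show ?case by (intro exI[of _ "\<lambda>_. []"]) auto
next
  case (Suc d)
  define n :: nat where "n = 2 ^ d"
  have bij: "bij_betw \<pi> {..<2 * n} {..<2 * n}" using Suc.prems by (simp add: n_def)
  then have inj: "inj_on \<pi> {..<2 * n}" and im: "\<pi> ` {..<2 * n} = {..<2 * n}"
    by (auto simp: bij_betw_def)
  obtain col :: "nat \<Rightarrow> bool" where col: "\<And>s s'. \<lbrakk>s < 2 * n; s' < 2 * n; s \<noteq> s';
      s div 2 = s' div 2 \<or> \<pi> s div 2 = \<pi> s' div 2\<rbrakk> \<Longrightarrow> col s \<noteq> col s'"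
    using benes_colouring[OF bij] by blast
  \<comment> \<open>Colours within a pair differ, so exactly one of the two contents stored in pair
    \<open>i\<close> travels through half \<open>c\<close>.\<close>
  define slot where "slot c i = (if col (2 * i) = c then 2 * i else 2 * i + 1)" for c i
  have slot: "slot c i < 2 * n" "col (slot c i) = c" "slot c i div 2 = i" if "i < n" for c i
    using col[of "2 * i" "2 * i + 1"] that by (auto simp: slot_def)
  have slot_eq: "slot (col s) (s div 2) = s" if "s < 2 * n" for s
  proof (rule ccontr)
    assume "slot (col s) (s div 2) \<noteq> s"
    moreover have "s div 2 < n" using that by simp
    ultimately show False
      using col[of s "slot (col s) (s div 2)"] slot[of "s div 2" "col s"] that by metis
  qed
  define \<pi>' where "\<pi>' c i = \<pi> (slot c i) div 2" for c i
  have \<pi>_less: "\<pi> s < 2 * n" if "s < 2 * n" for s using im that by auto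
  have bij': "bij_betw (\<pi>' c) {..<2 ^ d} {..<2 ^ d}" for c
  proof -
    have "inj_on (\<pi>' c) {..<n}"
    proof (rule inj_onI)
      fix i i' assume *: "i \<in> {..<n}" "i' \<in> {..<n}" "\<pi>' c i = \<pi>' c i'"
      then have "slot c i = slot c i'"
        unfolding \<pi>'_def using col[of "slot c i" "slot c i'"] slot[of i c] slot[of i' c]
        by (metis lessThan_iff)
      then have "slot c i div 2 = slot c i' div 2" by (rule arg_cong)
      then show "i = i'" using slot(3)[of i c] slot(3)[of i' c] * by (metis lessThan_iff)
    qed
    moreover have "\<pi>' c ` {..<n} \<subseteq> {..<n}"
      using \<pi>_less[OF slot(1)] by (auto simp: \<pi>'_def less_mult_imp_div_less mult.commute)
    ultimately show ?thesis
      unfolding n_def[symmetric] bij_betw_def by (simp add: endo_inj_surj)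
  qed
  define p' where "p' = p + n"
  define pt where "pt c = (if c then p else p')" for c
  have "\<forall>c. \<exists>S. (\<forall>t. subseq (S t) (mem_step d (pt c) t)) \<and>
    (\<forall>s<2 ^ d. s < \<pi>' c s \<longrightarrow> track S (pt c) s (\<pi>' c s) = pt c \<and>
       (\<forall>r. s < r \<and> r < \<pi>' c s \<longrightarrow> track S (pt c) s r \<noteq> pt c))"
    using Suc.IH[OF bij'] by blast
  from choice[OF this] obtain SS where SS: "\<forall>c. (\<forall>t. subseq (SS c t) (mem_step d (pt c) t)) \<and>
    (\<forall>s<2 ^ d. s < \<pi>' c s \<longrightarrow> track (SS c) (pt c) s (\<pi>' c s) = pt c \<and>
       (\<forall>r. s < r \<and> r < \<pi>' c s \<longrightarrow> track (SS c) (pt c) s r \<noteq> pt c))" ..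
  then have SS_sub: "\<And>c t. subseq (SS c t) (mem_step d (pt c) t)"
    and SS_end: "\<And>c s. \<lbrakk>s < n; s < \<pi>' c s\<rbrakk> \<Longrightarrow> track (SS c) (pt c) s (\<pi>' c s) = pt c"
    and SS_mid: "\<And>c s r. \<lbrakk>s < n; s < r; r < \<pi>' c s\<rbrakk> \<Longrightarrow> track (SS c) (pt c) s r \<noteq> pt c"
    unfolding n_def by (blast, blast, blast intro: less_trans)
  define R where "R c = {pt c..<pt c + n}" for c
  have n: "n > 0" by (simp add: n_def)
  have pR: "pt c \<in> R c" for c using n by (simp add: R_def)
  have disj: "l \<notin> R (\<not> c)" if "l \<in> R c" for l c
    using that by (auto simp: R_def pt_def p'_def split: if_splits)
  have SS_wires: "set (SS c t) \<subseteq> R c \<times> R c" for c t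
    using subseq_set_subset[OF SS_sub[of c t]] mem_step_wires[of d "pt c" t]
    unfolding R_def n_def by (rule order_trans)
  have pp: "p \<noteq> p'" using n by (simp add: p'_def)
  have not_port: "l \<noteq> p \<and> l \<noteq> p'" if "l \<in> R c" "l \<noteq> pt c" for l c
    using that n by (auto simp: R_def pt_def p'_def split: if_splits)
  define sw where "sw b = (if b then [(p, p')] else [])" for b
  have mv: "move (sw b) l = (if b \<and> l = p then p' else if b \<and> l = p' then p else l)" for b l
    by (simp add: sw_def)
  define \<rho> where "\<rho> = inv_into {..<2 * n} \<pi>"
  have \<rho>: "\<rho> t < 2 * n" "\<pi> (\<rho> t) = t" if "t < 2 * n" for t
    using inv_into_into[of t \<pi> "{..<2 * n}"] f_inv_into_f[of t \<pi> "{..<2 * n}"] that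
    unfolding im \<rho>_def by auto
  \<comment> \<open>The even step parks the content of access \<open>2 * i\<close> on
    \<open>p'\<close> unless it is wanted at once at \<open>2 * i + 1\<close>. The odd step first
    puts the contents of the pair on the ports of their halves (\<open>col (2 * i)\<close> means
    that the one parked on \<open>p'\<close> belongs to the half at \<open>p\<close>), then runs
    both halves, and finally brings to \<open>p\<close> what access \<open>2 * i + 2\<close> wants,
    namely the content stored at \<open>\<rho> (2 * i + 2)\<close>.\<close>
  define S where "S t = (if even t then sw (\<pi> t \<noteq> t + 1)
     else sw (col (t - 1)) @ SS True (t div 2) @ SS False (t div 2) @ sw (\<not> col (\<rho> (t + 1))))" for t
  have S_even: "S (2 * i) = sw (\<pi> (2 * i) \<noteq> 2 * i + 1)" for i
    by (simp add: S_def)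
  have S_odd: "S (2 * i + 1) = sw (col (2 * i)) @ SS True i @ SS False i @
      sw (\<not> col (\<rho> (2 * Suc i)))" for i
    by (simp add: S_def)
  have "subseq (S t) (mem_step (Suc d) p t)" for t
  proof -
    have s1: "subseq (sw b) [(p, p + 2 ^ d)]" for b by (simp add: sw_def p'_def n_def)
    have s2: "subseq (SS True (t div 2)) (mem_step d p (t div 2))"
      using SS_sub[of True] by (simp add: pt_def)
    have s3: "subseq (SS False (t div 2)) (mem_step d (p + 2 ^ d) (t div 2))"
      using SS_sub[of False] by (simp add: pt_def p'_def n_def)
    show ?thesis
    proof (cases "even t")
      case True
      then show ?thesis using s1 by (simp add: S_def)
    next
      case False
      have "subseq (sw (col (t - 1)) @ SS True (t div 2) @ SS False (t div 2) @ sw (\<not> col (\<rho> (t + 1))))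
        ([(p, p + 2 ^ d)] @ mem_step d p (t div 2) @ mem_step d (p + 2 ^ d) (t div 2) @
          [(p, p + 2 ^ d)])"
        by (intro list_emb_append_mono s1 s2 s3)
      then show ?thesis using False by (simp only: S_def mem_step.simps if_False)
    qed
  qed
  moreover have "track S p s (\<pi> s) = p \<and> (\<forall>r. s < r \<and> r < \<pi> s \<longrightarrow> track S p s r \<noteq> p)"
    if s: "s < 2 ^ Suc d" and lt: "s < \<pi> s" for s
  proof -
    have s: "s < 2 * n" using s by (simp add: n_def)
    define i j c where "i = s div 2" and "j = \<pi> s div 2" and "c = col s"
    have "i \<le> j" using lt by (simp add: i_def j_def div_le_mono)
    then consider "i = j" | "i < j" by linarith
    then show ?thesis
    proof cases
      case 1
      \<comment> \<open>Storing and fetching within one pair leaves only this case; the content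
        simply waits at the port.\<close>
      then have "even s" "\<pi> s = s + 1" using lt unfolding i_def j_def by presburger+
      then show ?thesis by (auto simp: track_Suc S_def mv)
    next
      case 2
      have i: "i < n" using s by (simp add: i_def)
      have ij: "\<pi>' c i = j" using slot_eq[OF s] by (simp add: \<pi>'_def i_def j_def c_def)
      define T where "T = track (SS c) (pt c) i"
      have T_R: "T r \<in> R c" for r
        unfolding T_def using SS_wires pR by (rule track_inside)
      have T_mid: "T r \<noteq> p \<and> T r \<noteq> p'" if "i < r" "r < j" for r
        using SS_mid[of i r c] i that ij not_port[OF T_R] by (simp add: T_def)
      have T_j: "T j = pt c" using SS_end[of i c] i 2 ij by (simp add: T_def)
      have tr: "track S p s (Suc t) = move (S t) (track S p s t)" if "s \<le> t" for t
        using that by (rule track_Suc)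
      have s_cases: "s = 2 * i \<or> s = 2 * i + 1" unfolding i_def by presburger
      have start: "move (sw (col (2 * i))) (track S p s (2 * i + 1)) = pt c"
        using s_cases
      proof
        assume e: "s = 2 * i"
        then have "\<pi> (2 * i) \<noteq> 2 * i + 1" using 2 by (auto simp: j_def)
        then have "track S p s (2 * i + 1) = p'"
          using tr[of "2 * i"] e S_even[of i] by (simp add: mv)
        then show ?thesis using e pp by (auto simp: mv c_def pt_def)
      next
        assume e: "s = 2 * i + 1"
        then have "col (2 * i) \<noteq> c" using col[of "2 * i" s] s by (simp add: c_def)
        then show ?thesis using e pp by (auto simp: mv pt_def)
      qed
      have adv: "track S p s (2 * Suc i') = move (sw (\<not> col (\<rho> (2 * Suc i')))) (T (Suc i'))"
        if "move (sw (col (2 * i'))) (track S p s (2 * i' + 1)) = T i'" "i \<le> i'" for i'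
      proof -
        have m: "move (SS False i') (move (SS True i') (T i')) = move (SS c i') (T i')"
        proof (cases c)
          case True
          then have "move (SS True i') (T i') \<in> R True"
            using move_inside[OF SS_wires] T_R by auto
          from disj[OF this] have "move (SS True i') (T i') \<notin> R False" by simp
          then show ?thesis using True move_outside[OF SS_wires] by simp
        next
          case False
          then have "T i' \<notin> R True" using disj[OF T_R, of i'] by simp
          then show ?thesis using False move_outside[OF SS_wires] by auto
        qed
        have "s \<le> 2 * i' + 1" using that(2) s_cases by auto
        then have "track S p s (2 * Suc i') = move (S (2 * i' + 1)) (track S p s (2 * i' + 1))"
          using tr[of "2 * i' + 1"] by simp
        also have "\<dots> = move (sw (\<not> col (\<rho> (2 * Suc i')))) (move (SS c i') (T i'))"
          unfolding S_odd move_append that(1) m ..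
        finally show ?thesis using that(2) by (simp add: T_def track_Suc)
      qed
      \<comment> \<open>Strictly between pairs \<open>i\<close> and \<open>j\<close> the content is
        inside its half and off both \<open>p\<close> and \<open>p'\<close>, so the outer swaps miss
        it.\<close>
      have stay: "track S p s (2 * r) = T r \<and> track S p s (2 * r + 1) = T r"
        if "track S p s (2 * r) = move (sw b) (T r)" "i < r" "r < j" for r b
      proof -
        have "track S p s (2 * r) = T r" using that T_mid[of r] by (simp add: mv)
        moreover have "s \<le> 2 * r" using that s_cases by auto
        ultimately show ?thesis using tr[of "2 * r"] S_even[of r] T_mid[of r] that by (simp add: mv)
      qed
      have pos: "track S p s (2 * Suc i') = move (sw (\<not> col (\<rho> (2 * Suc i')))) (T (Suc i'))"
        if "i \<le> i'" "i' < j" for i'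
        using that
      proof (induction i' rule: dec_induct)
        case base
        then show ?case using start by (intro adv) (auto simp: T_def)
      next
        case (step k)
        have "track S p s (2 * Suc k + 1) = T (Suc k)"
          using stay[OF step.IH] step.prems step.hyps by simp
        then show ?case using T_mid[of "Suc k"] step by (intro adv) (auto simp: mv)
      qed
      have mid: "track S p s (2 * r) \<noteq> p \<and> track S p s (2 * r + 1) \<noteq> p" if "i < r" "r < j" for r
      proof -
        have "track S p s (2 * r) = move (sw (\<not> col (\<rho> (2 * r)))) (T r)"
          using pos[of "r - 1"] that by simp
        from stay[OF this that] T_mid[OF that] show ?thesis by simp
      qed
      have at_j: "track S p s (2 * j) = move (sw (\<not> col (\<rho> (2 * j)))) (pt c)"
        using pos[of "j - 1"] 2 T_j by simp
      have inv: "\<rho> (\<pi> s) = s" using s inj by (simp add: \<rho>_def inv_into_f_f)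
      have \<pi>s: "\<pi> s < 2 * n" using \<pi>_less[OF s] .
      have "\<pi> s = 2 * j \<or> \<pi> s = 2 * j + 1" unfolding j_def by presburger
      then consider "\<pi> s = 2 * j" | "\<pi> s = 2 * j + 1" by blast
      then show ?thesis
      proof cases
        case e: 1
        have "\<rho> (2 * j) = s" using inv e by simp
        then have "track S p s (\<pi> s) = p"
          using at_j e by (simp add: mv pt_def c_def)
        moreover have "track S p s r \<noteq> p" if "s < r" "r < \<pi> s" for r
        proof -
          have "s = 2 * i \<and> r = 2 * i + 1 \<or> i < r div 2 \<and> r div 2 < j"
            using that(1) that(2)[unfolded e] s_cases by linarith
          then consider "s = 2 * i" "r = 2 * i + 1" | "i < r div 2" "r div 2 < j" by blast
          then show ?thesis
          proof cases
            case 1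
            then have "\<pi> (2 * i) \<noteq> 2 * i + 1" using e 2 by auto
            then show ?thesis using tr[of "2 * i"] 1 S_even[of i] pp by (simp add: mv)
          next
            case 2
            have "r = 2 * (r div 2) \<or> r = 2 * (r div 2) + 1" by presburger
            then show ?thesis using mid[OF 2] by metis
          qed
        qed
        ultimately show ?thesis by blast
      next
        case e: 2
        have j: "2 * j < 2 * n" using \<pi>s e by simp
        \<comment> \<open>The other content fetched in pair \<open>j\<close> has the opposite
          colour, so after the closing swap this one is on \<open>p'\<close>; the even step at
          \<open>2 * j\<close> then brings it to the port.\<close>
        have "\<rho> (2 * j) \<noteq> s" using \<rho>(2)[OF j] e by auto
        then have "col (\<rho> (2 * j)) \<noteq> c"
          using col[of "\<rho> (2 * j)" s] \<rho>[OF j] s e by (simp add: c_def)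
        then have at: "track S p s (2 * j) = p'"
          using at_j pp by (auto simp: mv pt_def)
        have "2 * j \<noteq> s" using 2 s_cases by presburger
        then have "\<pi> (2 * j) \<noteq> 2 * j + 1" using inj_onD[OF inj, of "2 * j" s] j s e by auto
        then have "S (2 * j) = sw True" by (simp only: S_even) simp
        moreover have "track S p s (Suc (2 * j)) = move (S (2 * j)) (track S p s (2 * j))"
          using 2 s_cases by (intro tr) presburger
        ultimately have "track S p s (\<pi> s) = p" using e at pp by (simp add: mv)
        moreover have "track S p s r \<noteq> p" if "s < r" "r < \<pi> s" for r
        proof -
          have "s = 2 * i \<and> r = 2 * i + 1 \<or> i < r div 2 \<and> r div 2 < j \<or> r = 2 * j"
            using that(1) that(2)[unfolded e] s_cases by linarith
          then consider "s = 2 * i" "r = 2 * i + 1" | "i < r div 2" "r div 2 < j" | "r = 2 * j"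
            by blast
          then show ?thesis
          proof cases
            case 1
            then have "\<pi> (2 * i) \<noteq> 2 * i + 1" using e 2 by auto
            then show ?thesis using tr[of "2 * i"] 1 S_even[of i] pp by (simp add: mv)
          next
            case 2
            have "r = 2 * (r div 2) \<or> r = 2 * (r div 2) + 1" by presburger
            then show ?thesis using mid[OF 2] by metis
          next
            case 3
            then show ?thesis using at pp by simp
          qed
        qed
        ultimately show ?thesis by blast
      qed
    qed
  qed
  ultimately show ?case by (intro exI[of _ S]) simp
qed

section \<open>Simulating a circuit with the memory\<close>

definition swaps :: "(nat \<times> nat) list \<Rightarrow> circuit" where
  "swaps xs = map (\<lambda>(u, v). (swap_gate, [u, v])) xs"

lemma bij_move: "bij (move xs)"
proof (induction xs)
  case (Cons a xs)
  obtain u v where a: "a = (u, v)" by force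
  let ?\<tau> = "\<lambda>l. if l = u then v else if l = v then u else l"
  have "bij ?\<tau>" by (rule involuntory_imp_bij) auto
  then have "bij (move xs \<circ> ?\<tau>)" using Cons by (rule bij_comp)
  moreover have "move (a # xs) = move xs \<circ> ?\<tau>" by (auto simp: a fun_eq_iff)
  ultimately show ?case by (simp only:)
qed (simp add: bij_def inj_def surj_def)

text \<open>In \<open>F (b \<circ> loc)\<close>, logical wire \<open>q\<close> sits on wire
  \<open>loc q\<close>. Swaps act on \<open>loc\<close> alone, so \<open>F\<close> can stay
  abstract.\<close>

lemma run_swaps:
  assumes "\<And>u v. (u, v) \<in> set xs \<Longrightarrow> u \<noteq> v"
  shows "run_circuit (swaps xs) (\<lambda>b. F (b \<circ> loc)) = (\<lambda>b. F (b \<circ> (move xs \<circ> loc)))"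
  using assms
proof (induction xs arbitrary: loc)
  case Nil
  then show ?case by (simp add: swaps_def comp_def)
next
  case (Cons a xs)
  obtain u v where a: "a = (u, v)" by force
  let ?\<tau> = "\<lambda>l. if l = u then v else if l = v then u else l"
  have "u \<noteq> v" using Cons.prems[of u v] by (simp add: a)
  have "apply_gate swap_gate [u, v] (\<lambda>b. F (b \<circ> loc)) = (\<lambda>b. F (b \<circ> (?\<tau> \<circ> loc)))"
  proof
    fix b :: "nat \<Rightarrow> bool"
    have "b(u := b v, v := b u) \<circ> loc = b \<circ> (?\<tau> \<circ> loc)"
      using \<open>u \<noteq> v\<close> by (auto simp: fun_eq_iff)
    then show "apply_gate swap_gate [u, v] (\<lambda>b. F (b \<circ> loc)) b = F (b \<circ> (?\<tau> \<circ> loc))"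
      by (simp only: apply_gate_swap[OF \<open>u \<noteq> v\<close>])
  qed
  then have "run_circuit (swaps (a # xs)) (\<lambda>b. F (b \<circ> loc)) =
      run_circuit (swaps xs) (\<lambda>b. F (b \<circ> (?\<tau> \<circ> loc)))"
    by (simp add: swaps_def a)
  also have "\<dots> = (\<lambda>b. F (b \<circ> (move xs \<circ> (?\<tau> \<circ> loc))))"
    by (rule Cons.IH) (use Cons.prems in auto)
  also have "move xs \<circ> (?\<tau> \<circ> loc) = move (a # xs) \<circ> loc" by (auto simp: a fun_eq_iff)
  finally show ?case .
qed

lemma run_circuit_relabel_inj:
  assumes "inj loc"
  shows "run_circuit (relabel loc C) (\<lambda>b. F (b \<circ> loc)) = (\<lambda>b. run_circuit C F (b \<circ> loc))"
  using run_circuit_relabel[OF assms, of "\<lambda>_. 1" C F] by simp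

text \<open>Domain and range of \<open>E\<close> have equal size, hence so do their complements in
  the finite set \<open>A\<close>; any bijection between these completes the map.\<close>

lemma partial_injection_extends:
  assumes E: "E \<subseteq> A \<times> A" and "finite A"
    and fn: "\<And>s t t'. (s, t) \<in> E \<Longrightarrow> (s, t') \<in> E \<Longrightarrow> t = t'"
    and inj: "\<And>s s' t. (s, t) \<in> E \<Longrightarrow> (s', t) \<in> E \<Longrightarrow> s = s'"
  shows "\<exists>\<pi>. bij_betw \<pi> A A \<and> (\<forall>(s, t)\<in>E. \<pi> s = t)"
proof -
  define f where "f s = (THE t. (s, t) \<in> E)" for s
  have f: "f s = t" if "(s, t) \<in> E" for s t
    unfolding f_def using that fn by blast
  have fb: "bij_betw f (fst ` E) (snd ` E)"
  proof (rule bij_betw_imageI)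
    show "inj_on f (fst ` E)"
    proof (rule inj_onI)
      fix s s' assume "s \<in> fst ` E" "s' \<in> fst ` E" and eq: "f s = f s'"
      then obtain t t' where t: "(s, t) \<in> E" "(s', t') \<in> E" by auto
      then have "t = t'" using f[OF t(1)] f[OF t(2)] eq by simp
      then show "s = s'" using t inj by blast
    qed
    have "f ` fst ` E = (\<lambda>e. f (fst e)) ` E" by (rule image_image)
    also have "\<dots> = snd ` E" using f by (intro image_cong) auto
    finally show "f ` fst ` E = snd ` E" .
  qed
  have sub: "fst ` E \<subseteq> A" "snd ` E \<subseteq> A" using E by force+
  have "finite (fst ` E)" "finite (snd ` E)" using sub \<open>finite A\<close> finite_subset by blast+
  then have "card (A - fst ` E) = card (A - snd ` E)"
    using sub bij_betw_same_card[OF fb] card_Diff_subset by metis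
  with finite_same_card_bij[of "A - fst ` E" "A - snd ` E"]
  obtain g where g: "bij_betw g (A - fst ` E) (A - snd ` E)"
    using \<open>finite A\<close> by auto
  define \<pi> where "\<pi> s = (if s \<in> fst ` E then f s else g s)" for s
  have "bij_betw \<pi> (fst ` E) (snd ` E)"
    using bij_betw_cong[of "fst ` E" \<pi> f] fb by (simp add: \<pi>_def)
  moreover have "bij_betw \<pi> (A - fst ` E) (A - snd ` E)"
    using bij_betw_cong[of "A - fst ` E" \<pi> g] g by (simp add: \<pi>_def)
  ultimately have "bij_betw \<pi> (fst ` E \<union> (A - fst ` E)) (snd ` E \<union> (A - snd ` E))"
    by (rule bij_betw_combine) blast
  then have "bij_betw \<pi> A A" using sub by (simp only: Un_Diff_cancel Un_absorb1)
  moreover have "\<forall>(s, t)\<in>E. \<pi> s = t" 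
  proof clarify
    fix s t assume st: "(s, t) \<in> E"
    then have "s \<in> fst ` E" by force
    then show "\<pi> s = t" using f[OF st] by (simp add: \<pi>_def)
  qed
  ultimately show ?thesis by blast
qed

text \<open>
  Wires \<open>0, \<dots>, n - 1\<close> hold the data, wire \<open>n\<close> is a work wire and the memory starts at \<open>p = n + 1\<close>.
  Accesses \<open>t < n\<close> load data qubit \<open>t\<close>. Gate \<open>j\<close> owns the accesses \<open>n + 3 * j\<close> (move the first qubit
  to the work wire), \<open>n + 3 * j + 1\<close> (apply the gate) and \<open>n + 3 * j + 2\<close> (put the first qubit back);
  a one-qubit gate uses only the middle one. Access \<open>n + 3 * c + q\<close> unloads qubit \<open>q\<close>.
\<close>

locale schedule =
  fixes n c d :: nat and C :: circuit and G :: "complex mat set"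
  assumes C: "circuit_over G n C" and c: "length C = c"
    and arity: "\<And>M qs. (M, qs) \<in> set C \<Longrightarrow> length qs = 1 \<or> length qs = 2"
    and size: "2 * n + 3 * c \<le> 2 ^ d"
begin

abbreviation "p \<equiv> Suc n"

section \<open>Write and read times of the simulated qubits\<close>

definition gate_qs :: "nat \<Rightarrow> nat list" where
  "gate_qs j = snd (C ! j)"

text \<open>The access at which qubit \<open>q\<close> was last put into the memory before gate \<open>j\<close>.\<close>

primrec lastw :: "nat \<Rightarrow> nat \<Rightarrow> nat" where
  "lastw 0 q = q"
| "lastw (Suc j) q = (if q \<in> set (gate_qs j)
     then (if q = last (gate_qs j) then n + 3 * j + 1 else n + 3 * j + 2) else lastw j q)"

text \<open>Stage \<open>c\<close> is not a gate but the final unloading, which fetches every data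
  qubit.\<close>

definition reads :: "nat \<Rightarrow> nat set" where
  "reads j = (if j < c then set (gate_qs j) else {..<n})"

text \<open>In a gate on \<open>[u, v]\<close>, \<open>u\<close> is fetched one access before
  \<open>v\<close>; \<open>last\<close> covers \<open>v\<close> as well as the only qubit of a
  one-qubit gate.\<close>

definition read_time :: "nat \<Rightarrow> nat \<Rightarrow> nat" where
  "read_time j q = (if j < c then (if q = last (gate_qs j) then n + 3 * j + 1 else n + 3 * j)
     else n + 3 * c + q)"

lemma gate_qs_cases:
  assumes "j < c"
  obtains v where "gate_qs j = [v]" "v < n"
  | u v where "gate_qs j = [u, v]" "u < n" "v < n" "u \<noteq> v"
proof -
  have mem: "(fst (C ! j), gate_qs j) \<in> set C" using assms c by (simp add: gate_qs_def)
  have "distinct (gate_qs j)" "set (gate_qs j) \<subseteq> {..<n}"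
    using C mem unfolding circuit_over_def by fast+
  then show ?thesis using arity[OF mem] that
    by (auto simp: length_Suc_conv numeral_2_eq_2)
qed

lemma reads_less: "q \<in> reads j \<Longrightarrow> q < n"
  by (cases "j < c") (auto simp: reads_def elim: gate_qs_cases)

lemma lastw_less: "q < n \<Longrightarrow> lastw j q < n + 3 * j"
  by (induction j) auto

lemma lastw_Suc_le: "q < n \<Longrightarrow> lastw j q \<le> lastw (Suc j) q"
  using lastw_less[of q j] by auto

lemma lastw_mono: "q < n \<Longrightarrow> i \<le> j \<Longrightarrow> lastw i q \<le> lastw j q"
  using lift_Suc_mono_le[of "\<lambda>j. lastw j q"] lastw_Suc_le by blast

text \<open>Every use stores the qubit again at a new time. With \<open>lastw_label\<close> this
  makes the next read a function of the write time.\<close>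

lemma lastw_fresh:
  assumes "q \<in> reads i" "i < j" "j \<le> c"
  shows "lastw i q < lastw j q"
proof -
  have q: "q < n" using assms(1) by (rule reads_less)
  have "lastw i q < n + 3 * i" using q by (rule lastw_less)
  also have "\<dots> < lastw (Suc i) q" using assms by (auto simp: reads_def)
  also have "\<dots> \<le> lastw j q" using assms q by (intro lastw_mono) auto
  finally show ?thesis .
qed

lemma lastw_label:
  assumes "q < n" "q' < n" "i \<le> c" "j \<le> c" "lastw i q = lastw j q'"
  shows "q = q'"
proof -
  \<comment> \<open>Decodes a write time: times below \<open>n\<close> are loads; within the triple
    of a gate, residue 2 puts back the first qubit and residue 1 leaves the last one at the
    port.\<close>
  define lab where "lab s = (if s < n then s
    else if (s - n) mod 3 = 2 then hd (gate_qs ((s - n) div 3)) else last (gate_qs ((s - n) div 3)))" for s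
  have "lab (lastw j q) = q" if "q < n" "j \<le> c" for j q
    using that(2)
  proof (induction j)
    case 0
    then show ?case using that by (simp add: lab_def)
  next
    case (Suc j)
    have m: "Suc (3 * j) mod 3 = 1" "Suc (3 * j) div 3 = j"
      "Suc (Suc (3 * j)) mod 3 = 2" "Suc (Suc (3 * j)) div 3 = j" by presburger+
    have l: "lab (n + 3 * j + 1) = last (gate_qs j)" "lab (n + 3 * j + 2) = hd (gate_qs j)"
      by (simp_all add: lab_def m)
    have "j < c" using Suc.prems by simp
    then show ?case
    proof (cases rule: gate_qs_cases)
      case (1 v)
      then show ?thesis using Suc l(1) by simp
    next
      case (2 u v)
      then show ?thesis using Suc l by simp
    qed
  qed
  then show ?thesis using assms by metis
qed

lemma read_time_inject:
  assumes "i \<le> c" "j \<le> c" "q \<in> reads i" "q' \<in> reads j" "read_time i q = read_time j q'"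
  shows "i = j \<and> q = q'"
proof -
  have lo: "n + 3 * k \<le> read_time k r" and up: "k < c \<Longrightarrow> read_time k r \<le> n + 3 * k + 1"
    if "k \<le> c" for k r using that by (auto simp: read_time_def)
  have "i = j"
    using lo[OF assms(1), of q] lo[OF assms(2), of q'] up[OF assms(1), of q] up[OF assms(2), of q']
      assms(1,2,5) by linarith
  moreover have "q = q'"
  proof (cases "j < c")
    case True
    then show ?thesis using assms(3-5) unfolding \<open>i = j\<close>
      by (cases rule: gate_qs_cases) (auto simp: reads_def read_time_def split: if_splits)
  qed (use assms \<open>i = j\<close> in \<open>auto simp: read_time_def\<close>)
  ultimately show ?thesis by blast
qed

lemma exists_routing:
  obtains S \<pi> where "\<And>t. subseq (S t) (mem_step d p t)"
    "\<And>j q. j \<le> c \<Longrightarrow> q \<in> reads j \<Longrightarrow> \<pi> (lastw j q) = read_time j q"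
    "\<And>s. s < 2 ^ d \<Longrightarrow> s < \<pi> s \<Longrightarrow> track S p s (\<pi> s) = p"
    "\<And>s r. s < 2 ^ d \<Longrightarrow> s < r \<Longrightarrow> r < \<pi> s \<Longrightarrow> track S p s r \<noteq> p"
proof -
  \<comment> \<open>Each write is matched with the next read of the same qubit. This partial
    injection extends to a permutation, which \<open>routing\<close> can handle.\<close>
  define E where "E = {(lastw j q, read_time j q) | j q. j \<le> c \<and> q \<in> reads j}"
  have "\<exists>\<pi>. bij_betw \<pi> {..<2 ^ d} {..<2 ^ d} \<and> (\<forall>(s, t)\<in>E. \<pi> s = t)"
  proof (rule partial_injection_extends)
    have "lastw j q < 2 ^ d \<and> read_time j q < 2 ^ d" if "j \<le> c" "q \<in> reads j" for j q
      using reads_less[OF that(2)] lastw_less[OF reads_less[OF that(2)], of j] that size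
      by (auto simp: read_time_def)
    then show "E \<subseteq> {..<2 ^ d} \<times> {..<2 ^ d}" by (auto simp: E_def)
    show "s = s'" if st: "(s, t) \<in> E" "(s', t) \<in> E" for s s' t
    proof -
      obtain i q where 1: "i \<le> c" "q \<in> reads i" "s = lastw i q" "t = read_time i q"
        using st(1) by (auto simp: E_def)
      obtain j q' where 2: "j \<le> c" "q' \<in> reads j" "s' = lastw j q'" "t = read_time j q'"
        using st(2) by (auto simp: E_def)
      have "i = j \<and> q = q'" using 1 2 by (intro read_time_inject) auto
      then show ?thesis using 1 2 by simp
    qed
    show "t = t'" if st: "(s, t) \<in> E" "(s, t') \<in> E" for s t t'
    proof -
      obtain i q where 1: "i \<le> c" "q \<in> reads i" "s = lastw i q" "t = read_time i q"
        using st(1) by (auto simp: E_def)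
      obtain j q' where 2: "j \<le> c" "q' \<in> reads j" "s = lastw j q'" "t' = read_time j q'"
        using st(2) by (auto simp: E_def)
      have "q = q'" using lastw_label[of q q' i j] 1 2 reads_less by auto
      moreover have "i = j"
        using lastw_fresh[of q i j] lastw_fresh[of q' j i] 1 2 \<open>q = q'\<close>
        by (metis less_irrefl linorder_neqE_nat)
      ultimately show ?thesis using 1 2 by simp
    qed
  qed simp
  then obtain \<pi> where \<pi>: "bij_betw \<pi> {..<2 ^ d} {..<2 ^ d}" "\<forall>(s, t)\<in>E. \<pi> s = t" by blast
  obtain S where S: "\<forall>t. subseq (S t) (mem_step d p t)"
    "\<forall>s<2 ^ d. s < \<pi> s \<longrightarrow> track S p s (\<pi> s) = p \<and>
       (\<forall>r. s < r \<and> r < \<pi> s \<longrightarrow> track S p s r \<noteq> p)"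
    using routing[OF \<pi>(1), of p] by blast
  show ?thesis
  proof (rule that)
    show "\<pi> (lastw j q) = read_time j q" if "j \<le> c" "q \<in> reads j" for j q
    proof -
      have "(lastw j q, read_time j q) \<in> E" using that by (auto simp: E_def)
      then show ?thesis using \<pi>(2) by auto
    qed
    show "track S p s r \<noteq> p" if "s < 2 ^ d" "s < r" "r < \<pi> s" for s r
      using S(2) that less_trans by blast
  qed (use S in blast)+
qed

text \<open>The part of \<open>user_net\<close> that \<open>C\<close> switches on. A two-qubit gate
  finds its first qubit on the work wire and its second at the port, hence
  \<open>[n, p]\<close>.\<close>

definition user_sel :: "nat \<Rightarrow> circuit" where
  "user_sel t = (if t < n then swaps [(p, t)]
     else if t < n + 3 * c then
       (if (t - n) mod 3 = 1 then [(fst (C ! ((t - n) div 3)),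
           if length (gate_qs ((t - n) div 3)) = 1 then [p] else [n, p])]
        else if length (gate_qs ((t - n) div 3)) = 2 then swaps [(p, n)] else [])
     else if t < 2 * n + 3 * c then swaps [(p, t - n - 3 * c)] else [])"

lemma user_sel_gate:
  assumes "j < c"
  shows "user_sel (n + 3 * j) = (if length (gate_qs j) = 2 then swaps [(p, n)] else [])"
    "user_sel (Suc (n + 3 * j)) =
      [(fst (C ! j), if length (gate_qs j) = 1 then [p] else [n, p])]"
    "user_sel (Suc (Suc (n + 3 * j))) = (if length (gate_qs j) = 2 then swaps [(p, n)] else [])"
proof -
  have "Suc (3 * j) mod 3 = 1" "Suc (3 * j) div 3 = j"
    "Suc (Suc (3 * j)) mod 3 = 2" "Suc (Suc (3 * j)) div 3 = j" by presburger+
  moreover have "Suc (Suc (n + 3 * j)) - n = Suc (Suc (3 * j))" "Suc (n + 3 * j) - n = Suc (3 * j)"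
    by simp_all
  ultimately show "user_sel (n + 3 * j) = (if length (gate_qs j) = 2 then swaps [(p, n)] else [])"
    "user_sel (Suc (n + 3 * j)) =
      [(fst (C ! j), if length (gate_qs j) = 1 then [p] else [n, p])]"
    "user_sel (Suc (Suc (n + 3 * j))) = (if length (gate_qs j) = 2 then swaps [(p, n)] else [])"
    using assms by (simp_all add: user_sel_def)
qed

definition run_to :: "(nat \<Rightarrow> (nat \<times> nat) list) \<Rightarrow> nat \<Rightarrow> circuit" where
  "run_to S t = concat (map (\<lambda>t. user_sel t @ swaps (S t)) [0..<t])"

text \<open>At time \<open>t\<close> the first \<open>j\<close> gates have been performed, and data qubit \<open>q\<close> sits on wire \<open>X q\<close>.\<close>

definition simul :: "(nat \<Rightarrow> (nat \<times> nat) list) \<Rightarrow> nat \<Rightarrow> nat \<Rightarrow> (nat \<Rightarrow> nat) \<Rightarrow> bool" where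
  "simul S t j X \<longleftrightarrow> (\<forall>f. \<exists>loc. bij loc \<and> (\<forall>q<n. loc q = X q) \<and>
     run_circuit (run_to S t) f = (\<lambda>b. run_circuit (take j C) f (b \<circ> loc)))"

lemma simul_swap:
  assumes "simul S t j X" "user_sel t = swaps us"
    and "\<And>u v. (u, v) \<in> set us \<Longrightarrow> u \<noteq> v" "\<And>u v. (u, v) \<in> set (S t) \<Longrightarrow> u \<noteq> v"
    and X': "\<And>q. q < n \<Longrightarrow> move (S t) (move us (X q)) = X' q"
  shows "simul S (Suc t) j X'"
  unfolding simul_def
proof
  fix f
  obtain loc where loc: "bij loc" "\<forall>q<n. loc q = X q"
    "run_circuit (run_to S t) f = (\<lambda>b. run_circuit (take j C) f (b \<circ> loc))"
    using assms(1) unfolding simul_def by blast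
  define loc' where "loc' = move (S t) \<circ> (move us \<circ> loc)"
  have "bij loc'" unfolding loc'_def by (intro bij_comp loc bij_move)
  moreover have "\<forall>q<n. loc' q = X' q" using loc(2) X' by (simp add: loc'_def)
  moreover have "run_circuit (run_to S (Suc t)) f = (\<lambda>b. run_circuit (take j C) f (b \<circ> loc'))"
  proof -
    have "run_circuit (run_to S (Suc t)) f =
      run_circuit (swaps (S t)) (run_circuit (swaps us) (run_circuit (run_to S t) f))"
      by (simp add: run_to_def assms(2))
    also have "\<dots> = run_circuit (swaps (S t)) (\<lambda>b. run_circuit (take j C) f (b \<circ> (move us \<circ> loc)))"
      unfolding loc(3) by (subst run_swaps) (use assms(3) in auto)
    also have "\<dots> = (\<lambda>b. run_circuit (take j C) f (b \<circ> loc'))"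
      unfolding loc'_def by (rule run_swaps) (use assms(4) in auto)
    finally show ?thesis .
  qed
  ultimately show "\<exists>loc. bij loc \<and> (\<forall>q<n. loc q = X' q) \<and>
     run_circuit (run_to S (Suc t)) f = (\<lambda>b. run_circuit (take j C) f (b \<circ> loc))" by blast
qed

text \<open>Relabelling by \<open>loc\<close> moves gate \<open>j\<close> of \<open>C\<close> to
  where its qubits currently are, and running a circuit commutes with an injective
  relabelling.\<close>

lemma simul_gate:
  assumes "simul S t j X" "j < c" "user_sel t = [(fst (C ! j), map X (gate_qs j))]"
    and "\<And>u v. (u, v) \<in> set (S t) \<Longrightarrow> u \<noteq> v"
    and X': "\<And>q. q < n \<Longrightarrow> move (S t) (X q) = X' q"
  shows "simul S (Suc t) (Suc j) X'"
  unfolding simul_def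
proof
  fix f
  obtain loc where loc: "bij loc" "\<forall>q<n. loc q = X q"
    "run_circuit (run_to S t) f = (\<lambda>b. run_circuit (take j C) f (b \<circ> loc))"
    using assms(1) unfolding simul_def by blast
  define loc' where "loc' = move (S t) \<circ> loc"
  have "bij loc'" unfolding loc'_def by (intro bij_comp loc bij_move)
  moreover have "\<forall>q<n. loc' q = X' q" using loc(2) X' by (simp add: loc'_def)
  moreover have "run_circuit (run_to S (Suc t)) f = (\<lambda>b. run_circuit (take (Suc j) C) f (b \<circ> loc'))"
  proof -
    have "\<forall>q\<in>set (gate_qs j). q < n"
      using reads_less[of _ j] assms(2) by (auto simp: reads_def)
    then have gate: "[(fst (C ! j), map X (gate_qs j))] = relabel loc [C ! j]"
      using loc(2) by (simp add: relabel_def gate_qs_def case_prod_unfold)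
    have tk: "take (Suc j) C = take j C @ [C ! j]" using assms(2) c by (simp add: take_Suc_conv_app_nth)
    have "run_circuit (run_to S (Suc t)) f =
      run_circuit (swaps (S t)) (run_circuit (relabel loc [C ! j]) (run_circuit (run_to S t) f))"
      by (simp add: run_to_def assms(3) flip: gate)
    also have "\<dots> = run_circuit (swaps (S t)) (\<lambda>b. run_circuit (take (Suc j) C) f (b \<circ> loc))"
      unfolding loc(3) run_circuit_relabel_inj[OF bij_is_inj[OF loc(1)]] tk run_circuit_simps ..
    also have "\<dots> = (\<lambda>b. run_circuit (take (Suc j) C) f (b \<circ> loc'))"
      unfolding loc'_def by (rule run_swaps) (use assms(4) in auto)
    finally show ?thesis .
  qed
  ultimately show "\<exists>loc. bij loc \<and> (\<forall>q<n. loc q = X' q) \<and>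
     run_circuit (run_to S (Suc t)) f = (\<lambda>b. run_circuit (take (Suc j) C) f (b \<circ> loc))" by blast
qed

lemma simul_cong: "simul S t j X \<Longrightarrow> (\<And>q. q < n \<Longrightarrow> X q = X' q) \<Longrightarrow> simul S t j X'"
  unfolding simul_def by simp

lemma simulation:
  obtains S where "\<And>t. subseq (S t) (mem_step d p t)" "simul S (2 ^ d) c (\<lambda>q. q)"
proof -
  obtain S \<pi> where S: "\<And>t. subseq (S t) (mem_step d p t)"
    and \<pi>: "\<And>j q. j \<le> c \<Longrightarrow> q \<in> reads j \<Longrightarrow> \<pi> (lastw j q) = read_time j q"
    and at: "\<And>s. s < 2 ^ d \<Longrightarrow> s < \<pi> s \<Longrightarrow> track S p s (\<pi> s) = p"
    and off: "\<And>s r. s < 2 ^ d \<Longrightarrow> s < r \<Longrightarrow> r < \<pi> s \<Longrightarrow> track S p s r \<noteq> p"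
    using exists_routing by metis
  have S_wires: "set (S t) \<subseteq> {p..<p + 2 ^ d} \<times> {p..<p + 2 ^ d}" for t
    using subseq_set_subset[OF S] mem_step_wires by (rule order_trans)
  have dist: "\<And>u v. (u, v) \<in> set (S t) \<Longrightarrow> u \<noteq> v" for t
    using subseq_set_subset[OF S] mem_step_distinct by blast
  have out: "move (S t) l = l" if "l \<le> n" for t l
    using that by (intro move_outside[OF S_wires]) simp
  have tr: "move (S t) (track S p s t) = track S p s (Suc t)" if "s \<le> t" for s t
    using that by (simp add: track_Suc)
  have tr0: "move (S t) p = track S p t (Suc t)" for t using tr[of t t] by simp
  have ge: "p \<le> track S p s t" for s t
    using track_inside[of S "{p..<p + 2 ^ d}" p s t] S_wires by auto
  have ne: "track S p s t \<noteq> l" if "l \<le> n" for s t l using ge[of s t] that by simp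
  have lw: "lastw j q < 2 ^ d" if "q < n" "j \<le> c" for j q
    using lastw_less[OF that(1), of j] that size by simp
  have nxt: "n + 3 * j \<le> \<pi> (lastw j q)" if "q < n" "j \<le> c" for j q
    using that(2)
  proof (induction rule: inc_induct)
    case base
    then show ?case using \<pi>[of c q] that by (simp add: reads_def read_time_def)
  next
    case (step j)
    show ?case
    proof (cases "q \<in> set (gate_qs j)")
      case True
      then show ?thesis using \<pi>[of j q] step by (auto simp: reads_def read_time_def)
    next
      case False
      then show ?thesis using step by simp
    qed
  qed
  have nxt': "n + 3 * j + 3 \<le> \<pi> (lastw j q)" if "q < n" "j < c" "q \<notin> set (gate_qs j)" for j q
    using nxt[of q "Suc j"] that by simp
  have arr: "track S p (lastw j q) (read_time j q) = p" if "j \<le> c" "q \<in> reads j" for j q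
  proof -
    have q: "q < n" using that(2) by (rule reads_less)
    have "lastw j q < \<pi> (lastw j q)" using lastw_less[OF q, of j] nxt[OF q that(1)] by simp
    from at[OF lw[OF q that(1)] this] show ?thesis using \<pi>[OF that] by simp
  qed
  \<comment> \<open>Operations at the port must not disturb other qubits: between being stored and
    its next use a qubit is never there.\<close>
  have nar: "track S p (lastw j q) r \<noteq> p" if "q < n" "j \<le> c" "lastw j q < r" "r < \<pi> (lastw j q)" for j q r
    using off[OF lw[OF that(1,2)] that(3,4)] .
  have load: "simul S t 0 (\<lambda>q. if q < t then track S p q t else q)" if "t \<le> n" for t
    using that
  proof (induction t)
    case 0
    have "bij (\<lambda>x::nat. x)" by (simp add: bij_def inj_def surj_def)
    then show ?case by (auto simp: simul_def run_to_def comp_def intro!: exI[of _ "\<lambda>x. x"])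
  next
    case (Suc t)
    have IH: "simul S t 0 (\<lambda>q. if q < t then track S p q t else q)" using Suc by simp
    show ?case
    proof (rule simul_swap[OF IH])
      show "user_sel t = swaps [(p, t)]" using Suc.prems by (simp add: user_sel_def)
      fix q assume q: "q < n"
      have "track S p q t \<noteq> p" if "q < t"
        using nar[of q 0 t] nxt[of q 0] that q Suc.prems by simp
      then show "move (S t) (move [(p, t)] (if q < t then track S p q t else q)) =
          (if q < Suc t then track S p q (Suc t) else q)"
        using q Suc.prems ne[of t q t] tr[of q t] tr0[of t] out[of q t] by (auto simp: less_Suc_eq)
    qed (use Suc.prems dist in auto)
  qed
  have gates: "simul S (n + 3 * j) j (\<lambda>q. track S p (lastw j q) (n + 3 * j))" if "j \<le> c" for j
    using that
  proof (induction j)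
    case 0
    then show ?case using simul_cong[OF load[of n]] by simp
  next
    case (Suc j)
    have j: "j < c" using Suc.prems by simp
    have IH: "simul S (n + 3 * j) j (\<lambda>q. track S p (lastw j q) (n + 3 * j))" using Suc by simp
    have less: "lastw j q < n + 3 * j" if "q < n" for q using that by (rule lastw_less)
    from j show ?case
    proof (cases rule: gate_qs_cases)
      case (1 v)
      have v: "track S p (lastw j v) (Suc (n + 3 * j)) = p"
        using arr[of j v] j 1 by (simp add: reads_def read_time_def)
      have "simul S (Suc (n + 3 * j)) j (\<lambda>q. track S p (lastw j q) (Suc (n + 3 * j)))"
      proof (rule simul_swap[OF IH, where us = "[]"])
        show "user_sel (n + 3 * j) = swaps []" using user_sel_gate(1)[OF j] 1 by (simp add: swaps_def)
      qed (use dist less tr in \<open>auto simp: less_imp_le\<close>)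
      then have "simul S (Suc (Suc (n + 3 * j))) (Suc j)
          (\<lambda>q. track S p (lastw (Suc j) q) (Suc (Suc (n + 3 * j))))"
      proof (rule simul_gate[OF _ j])
        show "user_sel (Suc (n + 3 * j)) = [(fst (C ! j),
            map (\<lambda>q. track S p (lastw j q) (Suc (n + 3 * j))) (gate_qs j))]"
          using user_sel_gate(2)[OF j] 1 v by simp
        fix q assume q: "q < n"
        show "move (S (Suc (n + 3 * j))) (track S p (lastw j q) (Suc (n + 3 * j))) =
            track S p (lastw (Suc j) q) (Suc (Suc (n + 3 * j)))"
        proof (cases "q = v")
          case True
          then show ?thesis using v tr0[of "Suc (n + 3 * j)"] 1 by simp
        next
          case False
          then show ?thesis using tr[of "lastw j q" "Suc (n + 3 * j)"] less[OF q] 1 by simp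
        qed
      qed (use dist in auto)
      then have "simul S (Suc (Suc (Suc (n + 3 * j)))) (Suc j)
          (\<lambda>q. track S p (lastw (Suc j) q) (Suc (Suc (Suc (n + 3 * j)))))"
      proof (rule simul_swap[where us = "[]"])
        show "user_sel (Suc (Suc (n + 3 * j))) = swaps []"
          using user_sel_gate(3)[OF j] 1 by (simp add: swaps_def)
        fix q assume q: "q < n"
        have "lastw (Suc j) q \<le> Suc (Suc (n + 3 * j))" using lastw_less[OF q, of "Suc j"] by simp
        from tr[OF this] show "move (S (Suc (Suc (n + 3 * j))))
            (move [] (track S p (lastw (Suc j) q) (Suc (Suc (n + 3 * j))))) =
            track S p (lastw (Suc j) q) (Suc (Suc (Suc (n + 3 * j))))" by (simp only: move.simps)
      qed (use dist in auto)
      then show ?thesis by (simp add: numeral_3_eq_3)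
    next
      case (2 u v)
      have u: "track S p (lastw j u) (n + 3 * j) = p"
        using arr[of j u] j 2 by (simp add: reads_def read_time_def)
      have v: "track S p (lastw j v) (Suc (n + 3 * j)) = p"
        using arr[of j v] j 2 by (simp add: reads_def read_time_def)
      have "simul S (Suc (n + 3 * j)) j
          (\<lambda>q. if q = u then n else track S p (lastw j q) (Suc (n + 3 * j)))"
      proof (rule simul_swap[OF IH, where us = "[(p, n)]"])
        show "user_sel (n + 3 * j) = swaps [(p, n)]" using user_sel_gate(1)[OF j] 2 by simp
        fix q assume q: "q < n"
        \<comment> \<open>The exchange with the work wire must hit only \<open>u\<close>:
          \<open>v\<close> is due one access later and all other qubits after this gate.\<close>
        have "n + 3 * j < \<pi> (lastw j q)" if "q \<noteq> u"
        proof (cases "q = v")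
          case True
          then show ?thesis using \<pi>[of j v] j 2 by (simp add: reads_def read_time_def)
        next
          case False
          then show ?thesis using nxt'[OF q j] that 2 by simp
        qed
        then have "track S p (lastw j q) (n + 3 * j) \<noteq> p" if "q \<noteq> u"
          using nar[of q j "n + 3 * j"] that q j less[OF q] by simp
        then show "move (S (n + 3 * j)) (move [(p, n)] (track S p (lastw j q) (n + 3 * j))) =
            (if q = u then n else track S p (lastw j q) (Suc (n + 3 * j)))"
          using u out[of n "n + 3 * j"] ne[of n "lastw j q" "n + 3 * j"]
            tr[of "lastw j q" "n + 3 * j"] less[OF q] by auto
      qed (use dist in auto)
      then have "simul S (Suc (Suc (n + 3 * j))) (Suc j)
          (\<lambda>q. if q = u then n else track S p (lastw (Suc j) q) (Suc (Suc (n + 3 * j))))"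
      proof (rule simul_gate[OF _ j])
        show "user_sel (Suc (n + 3 * j)) = [(fst (C ! j), map
            (\<lambda>q. if q = u then n else track S p (lastw j q) (Suc (n + 3 * j))) (gate_qs j))]"
          using user_sel_gate(2)[OF j] 2 v by simp
        fix q assume q: "q < n"
        show "move (S (Suc (n + 3 * j)))
            (if q = u then n else track S p (lastw j q) (Suc (n + 3 * j))) =
            (if q = u then n else track S p (lastw (Suc j) q) (Suc (Suc (n + 3 * j))))"
        proof (cases "q = v")
          case True
          then show ?thesis using v tr0[of "Suc (n + 3 * j)"] 2 by simp
        next
          case False
          then show ?thesis
            using tr[of "lastw j q" "Suc (n + 3 * j)"] less[OF q] 2 out[of n "Suc (n + 3 * j)"] by simp
        qed
      qed (use dist in auto)
      then have "simul S (Suc (Suc (Suc (n + 3 * j)))) (Suc j)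
          (\<lambda>q. track S p (lastw (Suc j) q) (Suc (Suc (Suc (n + 3 * j)))))"
      proof (rule simul_swap[where us = "[(p, n)]"])
        let ?T = "Suc (Suc (n + 3 * j))"
        show "user_sel ?T = swaps [(p, n)]" using user_sel_gate(3)[OF j] 2 by simp
        fix q assume q: "q < n"
        show "move (S ?T) (move [(p, n)] (if q = u then n else track S p (lastw (Suc j) q) ?T)) =
            track S p (lastw (Suc j) q) (Suc ?T)"
        proof (cases "q = u")
          case True
          then have "lastw (Suc j) q = ?T" using 2 by simp
          then show ?thesis using True tr0[of ?T] by simp
        next
          case False
          then have l: "lastw (Suc j) q < ?T" using 2 less[OF q] by simp
          have "?T < \<pi> (lastw (Suc j) q)" using nxt[OF q Suc.prems] by (simp del: lastw.simps)
          then have "track S p (lastw (Suc j) q) ?T \<noteq> p" using nar[OF q Suc.prems l] by blast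
          then have "move [(p, n)] (track S p (lastw (Suc j) q) ?T) = track S p (lastw (Suc j) q) ?T"
            using ne[of n "lastw (Suc j) q" ?T] by (simp del: lastw.simps)
          then show ?thesis using False tr[OF less_imp_le[OF l]] by (simp only: if_False)
        qed
      qed (use dist in auto)
      then show ?thesis by (simp add: numeral_3_eq_3)
    qed
  qed
  have unload: "simul S (n + 3 * c + i) c
      (\<lambda>q. if q < i then q else track S p (lastw c q) (n + 3 * c + i))" if "i \<le> n" for i
    using that
  proof (induction i)
    case 0
    then show ?case using gates[of c] by simp
  next
    case (Suc i)
    let ?T = "n + 3 * c + i"
    have i: "i < n" using Suc.prems by simp
    have IH: "simul S ?T c (\<lambda>q. if q < i then q else track S p (lastw c q) ?T)" using Suc by simp
    have at_i: "track S p (lastw c i) ?T = p"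
      using arr[of c i] i by (simp add: reads_def read_time_def)
    have "simul S (Suc ?T) c (\<lambda>q. if q < Suc i then q else track S p (lastw c q) (Suc ?T))"
    proof (rule simul_swap[OF IH, where us = "[(p, i)]"])
      show "user_sel ?T = swaps [(p, i)]" using i by (simp add: user_sel_def)
      fix q assume q: "q < n"
      have l: "lastw c q < ?T" using lastw_less[OF q, of c] by simp
      consider "q < i" | "q = i" | "q > i" by linarith
      then show "move (S ?T) (move [(p, i)] (if q < i then q else track S p (lastw c q) ?T)) =
          (if q < Suc i then q else track S p (lastw c q) (Suc ?T))"
      proof cases
        case 1
        then show ?thesis using q out[of q ?T] by simp
      next
        case 2
        then show ?thesis using at_i q out[of q ?T] by simp
      next
        case 3
        have "\<pi> (lastw c q) = n + 3 * c + q" using \<pi>[of c q] q by (simp add: reads_def read_time_def)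
        then have "track S p (lastw c q) ?T \<noteq> p" using nar[OF q _ l] 3 by simp
        then show ?thesis
          using 3 ne[of i "lastw c q" ?T] i tr[OF less_imp_le[OF l]] by simp
      qed
    qed (use i dist in auto)
    then show ?case unfolding add_Suc_right .
  qed
  \<comment> \<open>Accesses from \<open>2 * n + 3 * c\<close> on only shuffle memory cells, which
    lie above the data wires.\<close>
  have idle: "simul S (2 * n + 3 * c + k) c (\<lambda>q. q)" for k
  proof (induction k)
    case 0
    have e: "2 * n + 3 * c + 0 = n + 3 * c + n" by simp
    show ?case unfolding e by (rule simul_cong[OF unload[of n]]) simp_all
  next
    case (Suc k)
    have "simul S (Suc (2 * n + 3 * c + k)) c (\<lambda>q. q)"
    proof (rule simul_swap[OF Suc, where us = "[]"])
      show "user_sel (2 * n + 3 * c + k) = swaps []" by (simp add: user_sel_def swaps_def)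
    qed (use dist out in auto)
    then show ?case by simp
  qed
  have "simul S (2 ^ d) c (\<lambda>q. q)" using idle[of "2 ^ d - (2 * n + 3 * c)"] size by simp
  then show ?thesis using that S by blast
qed

text \<open>\<open>loc\<close> fixes the data wires and permutes the wires from \<open>n\<close> on
  among themselves. These are zero wherever the run of \<open>C\<close> is nonzero, so the
  permutation is invisible.\<close>

lemma run_simulation:
  assumes "simul S (2 ^ d) c (\<lambda>q. q)" "length y = n"
  shows "run_circuit (run_to S (2 ^ d)) (basis_state y) = run_circuit C (basis_state y)"
proof -
  let ?F = "run_circuit C (basis_state y)"
  obtain loc where loc: "bij loc" "\<forall>q<n. loc q = q"
    "run_circuit (run_to S (2 ^ d)) (basis_state y) = (\<lambda>b. ?F (b \<circ> loc))"
    using assms(1) c unfolding simul_def by (metis order_refl take_all)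
  have zero: "\<not> b q" if "?F b \<noteq> 0" "q \<ge> n" for b q
    using run_circuit_basis_zero[OF that(1) circuit_over_wires[OF C]] assms(2) that(2) by simp
  have ge: "loc q \<ge> n \<longleftrightarrow> q \<ge> n" for q
  proof -
    have "q < n" if "loc q < n"
      using loc(2) that bij_is_inj[OF loc(1)] by (metis injD)
    then show ?thesis using loc(2) by (metis not_less)
  qed
  have "?F (b \<circ> loc) = ?F b" for b
  proof (cases "\<forall>q\<ge>n. \<not> b q")
    case True
    have "b \<circ> loc = b"
    proof
      fix q show "(b \<circ> loc) q = b q"
        using True ge[of q] loc(2) by (cases "q < n") auto
    qed
    then show ?thesis by simp
  next
    case False
    then obtain r where r: "r \<ge> n" "b r" by blast
    obtain q where q: "r = loc q" using bij_is_surj[OF loc(1)] by (metis surjD)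
    then have "(b \<circ> loc) q" "q \<ge> n" using r ge[of q] by auto
    then have "?F (b \<circ> loc) = 0" using zero by blast
    moreover have "?F b = 0" using zero r by blast
    ultimately show ?thesis by simp
  qed
  then show ?thesis using loc(3) by simp
qed

end

section \<open>The universal circuit\<close>

text \<open>
  Every gate is offered \<open>L\<close> times, although at most one copy is ever switched on: with \<open>L\<close> the length of
  a controlled swap circuit, this makes the total size divisible by \<open>L\<close>, so that it can be brought to
  the exact value by idle controlled swaps.
\<close>

definition user_net :: "nat \<Rightarrow> nat \<Rightarrow> nat \<Rightarrow> complex mat list \<Rightarrow> nat \<Rightarrow> circuit" where
  "user_net n c L Gs t = (if t < n then swaps [(Suc n, t)]
     else if t < n + 3 * c then
       (if (t - n) mod 3 = 1
        then concat (map (\<lambda>M. replicate L (M, if dim_row M = 2 then [Suc n] else [n, Suc n])) Gs)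
        else swaps [(Suc n, n)])
     else if t < 2 * n + 3 * c then swaps [(Suc n, t - n - 3 * c)] else [])"

definition network :: "nat \<Rightarrow> nat \<Rightarrow> nat \<Rightarrow> nat \<Rightarrow> complex mat list \<Rightarrow> circuit" where
  "network n c d L Gs =
     concat (map (\<lambda>t. user_net n c L Gs t @ swaps (mem_step d (Suc n) t)) [0..<2 ^ d])"

lemma circuit_over_Nil [simp]: "circuit_over G N []"
  by (simp add: circuit_over_def)

lemma circuit_over_append [simp]:
  "circuit_over G N (C @ D) \<longleftrightarrow> circuit_over G N C \<and> circuit_over G N D"
  by (auto simp: circuit_over_def)

lemma circuit_over_concat:
  "(\<And>C. C \<in> set Cs \<Longrightarrow> circuit_over G N C) \<Longrightarrow> circuit_over G N (concat Cs)"
  by (fastforce simp: circuit_over_def)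

lemma circuit_over_swaps:
  assumes "swap_gate \<in> G" "\<And>u v. (u, v) \<in> set xs \<Longrightarrow> u \<noteq> v \<and> u < N \<and> v < N"
  shows "circuit_over G N (swaps xs)"
  unfolding circuit_over_def swaps_def
  using assms by (fastforce simp: swap_gate_def mat_of_rows_list_def)

lemma network_over:
  assumes "\<And>M. M \<in> set Gs \<Longrightarrow> dim_row M = 2 \<or> dim_row M = 4"
  shows "circuit_over (insert swap_gate (set Gs)) (Suc n + 2 ^ d) (network n c d L Gs)"
proof -
  let ?G = "insert swap_gate (set Gs)" and ?N = "Suc n + 2 ^ d"
  have "circuit_over ?G ?N (swaps (mem_step d (Suc n) t))" for t
    using mem_step_wires[of d "Suc n" t] mem_step_distinct[of _ _ d "Suc n" t]
    by (intro circuit_over_swaps) auto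
  moreover have "circuit_over ?G ?N (concat (map (\<lambda>M. replicate L
      (M, if dim_row M = 2 then [Suc n] else [n, Suc n])) Gs))"
    using assms by (intro circuit_over_concat) (fastforce simp: circuit_over_def)
  then have "circuit_over ?G ?N (user_net n c L Gs t)" for t
    unfolding user_net_def
    by (auto intro!: circuit_over_swaps)
  ultimately show ?thesis
    unfolding network_def by (intro circuit_over_concat) auto
qed

section \<open>Size of the network\<close>

definition cost :: "(complex mat \<Rightarrow> nat) \<Rightarrow> circuit \<Rightarrow> nat" where
  "cost l P = (\<Sum>(V, qs)\<leftarrow>P. l V)"

lemma cost_simps [simp]:
  "cost l [] = 0" "cost l ((V, qs) # P) = l V + cost l P" "cost l (P @ Q) = cost l P + cost l Q"
  "cost l (replicate r (V, qs)) = r * l V"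
  by (simp_all add: cost_def sum_list_replicate)

lemma cost_swaps: "cost l (swaps xs) = l swap_gate * length xs"
  by (induction xs) (auto simp: swaps_def)

lemma cost_concat_upt: "cost l (concat (map f [0..<T])) = (\<Sum>t<T. cost l (f t))"
  by (induction T) auto

text \<open>A swap costs \<open>L\<close>, and \<open>L\<close> copies of a gate cost a multiple of
  \<open>L\<close> whatever the gate costs; exact padding needs this divisibility. Per access,
  \<open>1 + s * length Gs\<close> bounds the user part and \<open>2 * d\<close> the memory part on
  average.\<close>

lemma network_cost:
  assumes "l swap_gate = L" "\<And>M. M \<in> set Gs \<Longrightarrow> l M \<le> s"
  shows "\<exists>x. cost l (network n c d L Gs) = L * x \<and> x \<le> (1 + s * length Gs + 2 * d) * 2 ^ d"
proof -
  define u where "u t = (if t < n then 1 else if t < n + 3 * c then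
      (if (t - n) mod 3 = 1 then sum_list (map l Gs) else 1)
      else if t < 2 * n + 3 * c then 1 else 0)" for t
  have gates: "cost l (concat (map (\<lambda>M. replicate L (M, g M)) Hs)) = L * sum_list (map l Hs)" for g Hs
    by (induction Hs) (auto simp: algebra_simps)
  have user: "cost l (user_net n c L Gs t) = L * u t" for t
    unfolding user_net_def u_def by (simp add: gates cost_swaps assms(1))
  have "sum_list (map l Gs) \<le> s * length Gs"
    using assms(2) by (induction Gs) fastforce+
  then have u: "u t \<le> 1 + s * length Gs" for t by (simp add: u_def)
  have "cost l (network n c d L Gs) = (\<Sum>t<2 ^ d. L * (u t + length (mem_step d (Suc n) t)))"
    unfolding network_def cost_concat_upt by (simp add: user cost_swaps assms(1) algebra_simps)
  also have "\<dots> = L * ((\<Sum>t<2 ^ d. u t) + (\<Sum>t<2 ^ d. length (mem_step d (Suc n) t)))"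
    by (simp only: sum_distrib_left[symmetric] sum.distrib)
  finally have eq: "cost l (network n c d L Gs) =
      L * ((\<Sum>t<2 ^ d. u t) + (\<Sum>t<2 ^ d. length (mem_step d (Suc n) t)))" .
  have "(\<Sum>t<2 ^ d. u t) \<le> (1 + s * length Gs) * 2 ^ d"
    using sum_bounded_above[of "{..<2 ^ d}" u "1 + s * length Gs"] u by (simp add: mult.commute)
  then have "(\<Sum>t<2 ^ d. u t) + (\<Sum>t<2 ^ d. length (mem_step d (Suc n) t)) \<le>
      (1 + s * length Gs) * 2 ^ d + 2 * d * 2 ^ d"
    using mem_step_size by (rule add_mono)
  also have "\<dots> = (1 + s * length Gs + 2 * d) * 2 ^ d" by (simp add: algebra_simps)
  finally show ?thesis using eq by blast
qed

lemma subseq_concat_map: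
  "(\<And>t. t \<in> set ts \<Longrightarrow> subseq (f t) (g t)) \<Longrightarrow> subseq (concat (map f ts)) (concat (map g ts))"
  by (induction ts) (auto intro: list_emb_append_mono)

text \<open>Every gate slot offers all of \<open>G\<close>, wired by dimension to one or two qubits,
  and \<open>L > 0\<close> guarantees a copy of each.\<close>

lemma (in schedule) run_to_subseq:
  assumes S: "\<And>t. subseq (S t) (mem_step d p t)" and Gs: "set Gs = G" and "L > 0"
  shows "subseq (run_to S (2 ^ d)) (network n c d L Gs)"
  unfolding run_to_def network_def
proof (intro subseq_concat_map list_emb_append_mono)
  fix t
  show "subseq (swaps (S t)) (swaps (mem_step d p t))"
    unfolding swaps_def by (rule subseq_map[OF S])
  show "subseq (user_sel t) (user_net n c L Gs t)"
  proof (cases "n \<le> t \<and> t < n + 3 * c \<and> (t - n) mod 3 = 1")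
    case True
    define j where "j = (t - n) div 3"
    have j: "j < c" using True by (auto simp: j_def)
    let ?M = "fst (C ! j)"
    have "(?M, gate_qs j) \<in> set C" using j c by (simp add: gate_qs_def)
    then have M: "?M \<in> set Gs" "dim_row ?M = 2 ^ length (gate_qs j)"
      using C Gs unfolding circuit_over_def by fast+
    have "dim_row ?M = 2 \<longleftrightarrow> length (gate_qs j) = 1"
      using j M(2) by (cases rule: gate_qs_cases) auto
    then have "(?M, if length (gate_qs j) = 1 then [p] else [n, p]) \<in>
        set (concat (map (\<lambda>M. replicate L (M, if dim_row M = 2 then [p] else [n, p])) Gs))"
      using M(1) \<open>L > 0\<close> by auto
    then show ?thesis
      using True by (simp add: user_sel_def user_net_def subseq_singleton_left j_def)
  qed (auto simp: user_sel_def user_net_def)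
qed

lemma nat_ceiling_log2:
  fixes m :: nat
  assumes "m \<ge> 2"
  defines "k \<equiv> nat \<lceil>log 2 (real m)\<rceil>"
  shows "m \<le> 2 ^ k" "2 ^ k \<le> 2 * m" "k \<ge> 1"
proof -
  have pos: "log 2 (real m) \<ge> 1" using assms(1) by simp
  then have k: "real k = of_int \<lceil>log 2 (real m)\<rceil>" unfolding k_def by linarith
  have "real m = 2 powr log 2 (real m)" using assms(1) by simp
  also have "\<dots> \<le> 2 powr real k" using k by (intro powr_mono) auto
  also have "\<dots> = real (2 ^ k)" by (simp add: powr_realpow)
  finally show "m \<le> 2 ^ k" by linarith
  have "real (2 ^ k) = 2 powr real k" by (simp add: powr_realpow)
  also have "\<dots> \<le> 2 powr (log 2 (real m) + 1)" using k by (intro powr_mono) linarith+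
  also have "\<dots> = real (2 * m)" using assms(1) by (simp add: powr_add)
  finally show "2 ^ k \<le> 2 * m" by linarith
  show "k \<ge> 1" using pos k by linarith
qed

section \<open>Implementations of the controlled swap and of the controlled gates\<close>

lemma swap_gate_carrier: "swap_gate \<in> carrier_mat (2 ^ 2) (2 ^ 2)"
  by (auto simp: swap_gate_def mat_of_rows_list_def)

lemma implements_single:
  assumes "V \<in> carrier_mat (2 ^ k) (2 ^ k)"
  shows "implements k 0 [(V, [0..<k])] V"
proof -
  have "v \<otimes>\<^sub>v ket [] = v" for v
    by (rule eq_vecI) (auto simp: tensor_vec_def ket_def bits_index_def)
  then show ?thesis
    using assms by (simp add: implements_def gate_on_all left_mult_one_mat[OF assms])
qed

text \<open>The empty circuit is the identity, but a controlled swap sends the basis state 110 to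
  101. This yields \<open>L > 0\<close>.\<close>

lemma implements_controlled_swap_nonempty:
  assumes "implements 3 a C (controlled swap_gate)" "circuit_over G (3 + a) C"
  shows "C \<noteq> []"
proof
  assume "C = []"
  let ?y = "[True, True, False]"
  have "run_circuit C (basis_state ?y) = run_circuit [(controlled swap_gate, [0..<3])] (basis_state ?y)"
    using controlled_carrier[OF swap_gate_carrier] assms
    by (intro implements_run_circuit[of 3 a]) (auto simp: numeral_3_eq_3)
  also have "\<dots> = apply_gate (controlled swap_gate) [0, 1, 2] (basis_state ?y)"
    by (simp add: numeral_3_eq_3 numeral_2_eq_2)
  finally have "basis_state ?y (bits_fun ?y) =
      apply_gate (controlled swap_gate) [0, 1, 2] (basis_state ?y) (bits_fun ?y)"
    by (simp add: \<open>C = []\<close>)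
  also have "\<dots> = basis_state ?y ((bits_fun ?y)(1 := bits_fun ?y 2, 2 := bits_fun ?y 1))"
    using swap_gate_carrier
    by (subst apply_gate_controlled) (auto simp: apply_gate_swap bits_fun_def numeral_2_eq_2)
  also have "\<dots> = 0"
  proof -
    have "((bits_fun ?y)(1 := bits_fun ?y 2, 2 := bits_fun ?y 1)) 1 \<noteq> bits_fun ?y 1"
      by (simp add: bits_fun_def)
    then have "(bits_fun ?y)(1 := bits_fun ?y 2, 2 := bits_fun ?y 1) \<noteq> bits_fun ?y" by metis
    then show ?thesis by (simp only: basis_state_def) simp
  qed
  finally show False by (simp add: basis_state_def)
qed

lemma circuit_over_mono: "circuit_over G N C \<Longrightarrow> G \<subseteq> G' \<Longrightarrow> circuit_over G' N C"
  unfolding circuit_over_def by fast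

lemma universal_for_mono: "universal_for n m a U Cs \<Longrightarrow> Cs' \<subseteq> Cs \<Longrightarrow> universal_for n m a U Cs'"
  unfolding universal_for_def by blast

lemma controlled_impl_mono: "controlled_impl G A V D \<Longrightarrow> A \<le> A' \<Longrightarrow> controlled_impl G A' V D"
  unfolding controlled_impl_def by (meson order_trans)

lemma universal_for_empty: "universal_for n 0 0 [] {C. circuit_over G n C \<and> circuit_size C = 0}"
proof -
  have "1\<^sub>m (2 ^ n) *\<^sub>v ket y = ket y" if "length y = n" for y
    using that by (intro one_mult_mat_vec) (simp add: ket_def)
  then show ?thesis
    by (auto simp: universal_for_def circuit_size_def ket_append)
qed

lemma quantum_gate_carrier: "quantum_gate k M \<Longrightarrow> M \<in> carrier_mat (2 ^ k) (2 ^ k)"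
  by (simp add: quantum_gate_def)

text \<open>The swap gets a controlled swap circuit over \<open>simulation_gates\<close>, even if it
  belongs to \<open>G\<close>; closure under control covers the other gates. Summing all register
  sizes gives a common bound \<open>A\<close>.\<close>

lemma controlled_impls_exist:
  fixes G :: "complex mat set"
  assumes "finite G" "\<forall>M\<in>G. quantum_gate 1 M \<or> quantum_gate 2 M" "closed_under_control G"
  obtains D A s where "\<And>V. V \<in> insert swap_gate G \<Longrightarrow> controlled_impl (simulation_gates G) A V (D V)"
    "\<And>V. V \<in> insert swap_gate G \<Longrightarrow> length (D V) \<le> s" "D swap_gate \<noteq> []"
proof -
  let ?G = "simulation_gates G"
  have sub: "G \<subseteq> ?G" by (auto simp: simulation_gates_def)
  have "\<exists>a C. circuit_over ?G (3 + a) C \<and> implements 3 a C (controlled swap_gate)"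
  proof (cases "\<exists>a C. circuit_over G (3 + a) C \<and> implements 3 a C (controlled swap_gate)")
    case True
    then show ?thesis by (simp add: simulation_gates_def)
  next
    case False
    then have "controlled swap_gate \<in> ?G"
      unfolding simulation_gates_def if_not_P[OF False] by simp
    moreover have car: "controlled swap_gate \<in> carrier_mat (2 ^ 3) (2 ^ 3)"
      using controlled_carrier[OF swap_gate_carrier] by (simp add: numeral_3_eq_3)
    ultimately have "circuit_over ?G (3 + 0) [(controlled swap_gate, [0..<3])]"
      by (auto simp: circuit_over_def)
    then show ?thesis using implements_single[OF car] by blast
  qed
  then obtain a0 D0 where D0: "circuit_over ?G (3 + a0) D0" "implements 3 a0 D0 (controlled swap_gate)"
    by blast
  have ci0: "controlled_impl ?G (3 + a0) swap_gate D0"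
    unfolding controlled_impl_def using D0 swap_gate_carrier
    by (intro exI[of _ 2] exI[of _ a0]) (simp add: numeral_3_eq_3)
  have ne0: "D0 \<noteq> []" using implements_controlled_swap_nonempty[OF D0(2,1)] .
  obtain s where s: "\<And>k M. M \<in> G \<Longrightarrow> quantum_gate k M \<Longrightarrow> (\<exists>a C. circuit_over G (Suc k + a) C \<and>
      circuit_size C \<le> s \<and> implements (Suc k) a C (controlled M))"
    using assms(3) unfolding closed_under_control_def by blast
  have "\<forall>M\<in>G. \<exists>DA. controlled_impl ?G (snd DA) M (fst DA) \<and> length (fst DA) \<le> s"
  proof
    fix M assume M: "M \<in> G"
    then obtain k where k: "quantum_gate k M" using assms(2) by blast
    obtain a C where "circuit_over G (Suc k + a) C" "circuit_size C \<le> s"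
      "implements (Suc k) a C (controlled M)" using s[OF M k] by blast
    then have "controlled_impl ?G (Suc k + a) M C \<and> length C \<le> s"
      unfolding controlled_impl_def circuit_size_def
      using quantum_gate_carrier[OF k] circuit_over_mono[OF _ sub] by blast
    then show "\<exists>DA. controlled_impl ?G (snd DA) M (fst DA) \<and> length (fst DA) \<le> s"
      by (intro exI[of _ "(C, Suc k + a)"]) simp
  qed
  then obtain DA where DA: "\<And>M. M \<in> G \<Longrightarrow> controlled_impl ?G (snd (DA M)) M (fst (DA M))"
    "\<And>M. M \<in> G \<Longrightarrow> length (fst (DA M)) \<le> s"
    using bchoice[of G "\<lambda>M DA. controlled_impl ?G (snd DA) M (fst DA) \<and> length (fst DA) \<le> s"] by blast
  define A where "A = 3 + a0 + (\<Sum>M\<in>G. snd (DA M))"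
  show ?thesis
  proof (rule that)
    fix V assume V: "V \<in> insert swap_gate G"
    show "controlled_impl ?G A V ((\<lambda>V. if V = swap_gate then D0 else fst (DA V)) V)"
    proof (cases "V = swap_gate")
      case True
      then show ?thesis using controlled_impl_mono[OF ci0] by (simp add: A_def)
    next
      case False
      then have "V \<in> G" using V by simp
      then have "snd (DA V) \<le> A" using member_le_sum[of V G "\<lambda>M. snd (DA M)"] assms(1) by (simp add: A_def)
      then show ?thesis using controlled_impl_mono[OF DA(1)[OF \<open>V \<in> G\<close>]] False by simp
    qed
    show "length ((\<lambda>V. if V = swap_gate then D0 else fst (DA V)) V) \<le> s + length D0"
      using V DA(2)[of V] by auto
  qed (use ne0 in simp)
qed

theorem theorem3:
  fixes G :: "complex mat set"
  assumes "finite G"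
    and "\<forall>M\<in>G. quantum_gate 1 M \<or> quantum_gate 2 M"
    and "closed_under_control G"
  shows "\<exists>(k::nat) (U :: nat \<Rightarrow> nat \<Rightarrow> circuit) (m :: nat \<Rightarrow> nat \<Rightarrow> nat) (a :: nat \<Rightarrow> nat \<Rightarrow> nat).
    \<forall>n c. n > 0 \<longrightarrow>
      circuit_over (simulation_gates G) (n + m n c + a n c) (U n c) \<and>
      universal_for n (m n c) (a n c) (U n c) {C. circuit_over G n C \<and> circuit_size C = c} \<and>
      circuit_size (U n c) = k * (n + c) * nat \<lceil>log 2 (real (n + c))\<rceil>"
proof -
  let ?G = "simulation_gates G"
  obtain D A s where D: "\<And>V. V \<in> insert swap_gate G \<Longrightarrow> controlled_impl ?G A V (D V)"
    and s: "\<And>V. V \<in> insert swap_gate G \<Longrightarrow> length (D V) \<le> s" and ne: "D swap_gate \<noteq> []"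
    using controlled_impls_exist[OF assms] by metis
  define L where "L = length (D swap_gate)"
  have L: "L > 0" using ne by (simp add: L_def)
  obtain Gs where Gs: "set Gs = G" using finite_list[OF assms(1)] by blast
  have dims: "dim_row M = 2 \<or> dim_row M = 4" if "M \<in> G" for M
    using assms(2) that by (auto simp: quantum_gate_def)
  \<comment> \<open>Since \<open>d\<close> will be \<open>lg + 2\<close> with
    \<open>lg \<ge> 1\<close>, the factor \<open>1 + s * length Gs + 2 * d\<close> is at most
    \<open>(s * length Gs + 7) * lg\<close>; the 8 comes from
    \<open>2 ^ d = 4 * 2 ^ lg \<le> 8 * (n + c)\<close>.\<close>
  define K where "K = 8 * (s * length Gs + 7)"
  have ex: "\<exists>U m a. circuit_over ?G (n + m + a) U \<and>
      universal_for n m a U {C. circuit_over G n C \<and> circuit_size C = c} \<and>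
      circuit_size U = (L * K) * (n + c) * nat \<lceil>log 2 (real (n + c))\<rceil>" if n: "n > 0" for n c
  proof (cases "n + c \<ge> 2")
    \<comment> \<open>For \<open>n + c = 1\<close> the logarithm is zero and so must be the size;
      only the empty circuit on one qubit is to be simulated.\<close>
    case False
    then have "n = 1" "c = 0" using n by auto
    then show ?thesis
      using universal_for_empty[of n G]
      by (intro exI[of _ "[]"] exI[of _ 0]) (simp add: circuit_over_def circuit_size_def)
  next
    case True
    define lg where "lg = nat \<lceil>log 2 (real (n + c))\<rceil>"
    have lg: "n + c \<le> 2 ^ lg" "2 ^ lg \<le> 2 * (n + c)" "lg \<ge> 1"
      using nat_ceiling_log2[OF True] unfolding lg_def by auto
    \<comment> \<open>Room for all accesses:
      \<open>2 * n + 3 * c \<le> 4 * (n + c) \<le> 4 * 2 ^ lg\<close>.\<close>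
    define d where "d = lg + 2"
    have size: "2 * n + 3 * c \<le> 2 ^ d" using lg(1) by (simp add: d_def)
    obtain x where x: "cost (\<lambda>V. length (D V)) (network n c d L Gs) = L * x"
      "x \<le> (1 + s * length Gs + 2 * d) * 2 ^ d"
      using network_cost[of "\<lambda>V. length (D V)" L Gs s n c d] s Gs by (auto simp: L_def)
    have "1 + s * length Gs + 2 * d \<le> (s * length Gs + 7) * lg"
    proof -
      have "1 + s * length Gs + 2 * d = s * length Gs + 5 + 2 * lg" by (simp add: d_def)
      also have "\<dots> \<le> (s * length Gs + 5) * lg + 2 * lg"
        using lg(3) by (intro add_right_mono) (cases lg, auto)
      also have "\<dots> = (s * length Gs + 7) * lg" by (simp add: algebra_simps)
      finally show ?thesis .
    qed
    moreover have "2 ^ d \<le> 8 * (n + c)" using lg(2) by (simp add: d_def)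
    ultimately have "(1 + s * length Gs + 2 * d) * 2 ^ d \<le> ((s * length Gs + 7) * lg) * (8 * (n + c))"
      by (rule mult_le_mono)
    also have "\<dots> = K * (n + c) * lg" by (simp add: K_def algebra_simps)
    finally have xK: "x \<le> K * (n + c) * lg" using x(2) by linarith
    \<comment> \<open>Each added swap costs \<open>L\<close> once controlled and is left off by the
      encodings in use, so the size becomes exactly \<open>L * K * (n + c) * lg\<close>.\<close>
    define P where "P = network n c d L Gs @ replicate (K * (n + c) * lg - x) (swap_gate, [Suc n, n])"
    let ?N = "Suc n + 2 ^ d"
    have "circuit_over (insert swap_gate G) ?N P"
      unfolding P_def using network_over[of Gs n d c L] dims Gs swap_gate_carrier
      by (auto simp: circuit_over_def)
    from controlled_selection[OF D this, of n G] obtain U where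
      U: "circuit_over ?G (n + length P + (?N - n + A)) U"
      "circuit_size U = cost (\<lambda>V. length (D V)) P"
      "universal_for n (length P) (?N - n + A) U {C. circuit_over G n C \<and>
       (\<exists>S. subseq S P \<and> (\<forall>y. length y = n \<longrightarrow>
          run_circuit S (basis_state y) = run_circuit C (basis_state y)))}"
      unfolding cost_def by auto
    have "circuit_size U = L * x + (K * (n + c) * lg - x) * L"
      unfolding U(2) P_def by (simp add: x(1)) (simp add: L_def)
    also have "\<dots> = L * (x + (K * (n + c) * lg - x))" by (simp only: distrib_left mult.commute)
    also have "\<dots> = L * K * (n + c) * lg" using xK by simp
    finally have "circuit_size U = L * K * (n + c) * lg" .
    moreover have "universal_for n (length P) (?N - n + A) U {C. circuit_over G n C \<and> circuit_size C = c}"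
      using U(3)
    proof (rule universal_for_mono, safe)
      fix C assume C: "circuit_over G n C" "c = circuit_size C"
      interpret schedule n c d C G
      proof
        fix M qs assume "(M, qs) \<in> set C"
        then have "M \<in> G" "dim_row M = 2 ^ length qs" using C(1) unfolding circuit_over_def by fast+
        then have "(2::nat) ^ length qs = 2 ^ 1 \<or> (2::nat) ^ length qs = 2 ^ 2" using dims by fastforce
        then show "length qs = 1 \<or> length qs = 2" by (simp only: power_inject_exp)
      qed (use C size in \<open>simp_all add: circuit_size_def\<close>)
      obtain S where S: "\<And>t. subseq (S t) (mem_step d (Suc n) t)" "simul S (2 ^ d) c (\<lambda>q. q)"
        using simulation by blast
      have "subseq (run_to S (2 ^ d)) P"
        unfolding P_def using list_emb_append_mono[OF run_to_subseq[OF S(1) Gs L] list_emb_Nil] by simp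
      then show "\<exists>S. subseq S P \<and> (\<forall>y. length y = n \<longrightarrow>
          run_circuit S (basis_state y) = run_circuit C (basis_state y))"
        using run_simulation[OF S(2)] by blast
    qed
    ultimately show ?thesis using U(1) unfolding lg_def
      by (intro exI[of _ U] exI[of _ "length P"] exI[of _ "?N - n + A"] conjI)
  qed
  \<comment> \<open>Circuit, encoding length and ancilla count are chosen as one triple, so that the
    three functions fit together for every \<open>n\<close> and \<open>c\<close>.\<close>
  define Q where "Q n c Z \<longleftrightarrow> circuit_over ?G (n + fst (snd Z) + snd (snd Z)) (fst Z) \<and>
      universal_for n (fst (snd Z)) (snd (snd Z)) (fst Z) {C. circuit_over G n C \<and> circuit_size C = c} \<and>
      circuit_size (fst Z) = (L * K) * (n + c) * nat \<lceil>log 2 (real (n + c))\<rceil>" for n c Z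
  define W where "W n c = (SOME Z. Q n c Z)" for n c
  have "Q n c (W n c)" if n: "n > 0" for n c
  proof -
    obtain U m a where "Q n c (U, m, a)" using ex[OF n, of c] unfolding Q_def by auto
    then show ?thesis unfolding W_def by (rule someI)
  qed
  then show ?thesis
    unfolding Q_def
    by (intro exI[of _ "L * K"] exI[of _ "\<lambda>n c. fst (W n c)"] exI[of _ "\<lambda>n c. fst (snd (W n c))"]
        exI[of _ "\<lambda>n c. snd (snd (W n c))"] allI impI)
qed

end
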